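(* Let $1\le k\le d$, let $\mathcal{I}=\{I_1,\ldots,I_k\}$ be a partition of $\{1,\ldots,d\}$, and let $B_{\mathcal{I}}$ be the block associated to $\mathcal{I}$ and to the sequences $(j_n^1)_{n=1}^\infty=\cdots=(j_n^d)_{n=1}^\infty=(n)_{n=1}^\infty$. Let $(\mathbf{p},\mathbf{q})=(p_1,\ldots,p_d,q_1,\ldots,q_k)\in[1,\infty)^{d+k}$ with $\frac1{q_s}\le\sum_{r\in I_s}\frac1{p_r}$ for every $s\in\{1,\ldots,k\}$. Then for all Banach spaces $E_1,\ldots,E_d,F$, $$\prod\nolimits_{(\mathbf{q};\mathbf{p})}^{k,d,\mathcal{I}}(E_1,\ldots,E_d;F)=\mathcal{L}^{B_{\mathcal{I}}}_{\ell_{p_1}^w(\cdot),\ldots,\ell_{p_d}^w(\cdot);\ell_{q_1}(\cdot),\ldots,\ell_{q_k}(\cdot)}(E_1,\ldots,E_d;F)$$ isometrically. Moreover, for $(p_1,\ldots,p_d,q_1,\ldots,q_k)\in[1,\infty)^{d+k}$, one has $\frac1{q_s}\le\sum_{r\in I_s}\frac1{p_r}$ for every $s\in\{1,\ldots,k\}$ if and only if the $(d+k)$-tuple $(\ell_{p_1}^w(\cdot),\ldots,\ell_{p_d}^w(\cdot),\ell_{q_1}(\cdot),\ldots,\ell_{q_k}(\cdot))$ is $B_{\mathcal{I}}$-compatible.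
   Context: All Banach spaces are over $\mathbb{K}=\mathbb{R}$ or $\mathbb{C}$; $\mathcal{L}(E_1,\ldots,E_d;F)$ is the Banach space of continuous $d$-linear operators with the usual operator norm. A partition $\mathcal{I}=\{I_1,\ldots,I_k\}$ of $\{1,\ldots,d\}$ is an ordered collection of pairwise disjoint (nonempty) subsets with union $\{1,\ldots,d\}$; $s(r)$ denotes the unique $s$ with $r\in I_s$. For vectors $x_j^r\in E_r$, $\sum_{s=1}^k\sum_{r\in I_s}x^r_{n_s}*e_r$ denotes the $d$-tuple $(x^1_{n_{s(1)}},\ldots,x^d_{n_{s(d)}})$. $\ell_q(E)$ is the space of absolutely $q$-summable $E$-valued sequences with its usual norm, and $\ell_p^w(E)$ the space of weakly $p$-summable $E$-valued sequences with norm $\|(x_j)_j\|_{w,p}=\sup_{\varphi\in B_{E^*}}\left(\sum_j|\varphi(x_j)|^p\right)^{1/p}$. Partially multiple summing operators. For $(\mathbf{p},\mathbf{q})$ as in the claim, a $d$-linear operator $A:E_1\times\cdots\times E_d\to F$ is $\mathcal{I}$-partially multiple $(\mathbf{q};\mathbf{p})$-summing if there is $C>0$ such that $$\left(\sum_{n_1=1}^\infty\left(\cdots\left(\sum_{n_k=1}^\infty\left\|A\left(\sum_{s=1}^k\sum_{r\in I_s}x^r_{n_s}*e_r\right)\right\|^{q_k}\right)^{\frac{q_{k-1}}{q_k}}\cdots\right)^{\frac{q_1}{q_2}}\right)^{\frac1{q_1}}\le C\prod_{r=1}^d\|(x_j^r)_j\|_{w,p_r}$$ for all $(x_j^r)_j\in\ell_{p_r}^w(E_r)$,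 $r=1,\ldots,d$. The infimum of such $C$ is the norm $\pi_{(\mathbf{q};\mathbf{p})}(A)$, and the space of all such operators is $\prod_{(\mathbf{q};\mathbf{p})}^{k,d,\mathcal{I}}(E_1,\ldots,E_d;F)$. Block-summing operators. The block associated to $\mathcal{I}$ and to the sequences $(j_n^r)_n=(n)_n$ is $B_{\mathcal{I}}=\{(n_{s(1)},\ldots,n_{s(d)}):n_1,\ldots,n_k\in\mathbb{N}\}$. An operator $A\in\mathcal{L}(E_1,\ldots,E_d;F)$ belongs to $\mathcal{L}^{B_{\mathcal{I}}}_{\ell_{p_1}^w(\cdot),\ldots,\ell_{p_d}^w(\cdot);\ell_{q_1}(\cdot),\ldots,\ell_{q_k}(\cdot)}(E_1,\ldots,E_d;F)$ if the iterated sequence $\left(\cdots\left(A\left(\sum_{s=1}^k\sum_{r\in I_s}x^r_{n_s}*e_r\right)\right)_{n_k=1}^\infty\cdots\right)_{n_1=1}^\infty$ belongs to $\ell_{q_1}(\cdots\ell_{q_k}(F)\cdots)$ whenever $(x_j^r)_j\in\ell_{p_r}^w(E_r)$, $r=1,\ldots,d$; its norm is the operator norm of the induced continuous $d$-linear operator $\ell_{p_1}^w(E_1)\times\cdots\times\ell_{p_d}^w(E_d)\to\ell_{q_1}(\cdots\ell_{q_k}(F)\cdots)$. Compatibility. The tuple $(\ell_{p_1}^w(\cdot),\ldots,\ell_{p_d}^w(\cdot),\ell_{q_1}(\cdot),\ldots,\ell_{q_k}(\cdot))$ is $B_{\mathcal{I}}$-compatible if for all $(\lambda_j^r)_j\in\ell_{p_r}^w(\mathbb{K})$,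 $r=1,\ldots,d$, the iterated sequence $\left(\cdots\left(\prod_{s=1}^k\prod_{r\in I_s}\lambda^r_{n_s}\right)_{n_k=1}^\infty\cdots\right)_{n_1=1}^\infty$ belongs to $\ell_{q_1}(\cdots\ell_{q_k}(\mathbb{K})\cdots)$ and has norm at most $\prod_{r=1}^d\|(\lambda_j^r)_j\|_{\ell_{p_r}^w(\mathbb{K})}$. *)

theory Defs
  imports "HOL-Analysis.Analysis"
begin

section \<open>Banach spaces over the scalar field\<close>

text \<open>
  The scalar field K is a type variable \<open>'k\<close> of class \<open>real_normed_field\<close>. By the
  Mazur--Frobenius theorem the only instances of that class are, up to isometric isomorphism, the
  real and the complex numbers with their absolute value, so that quantifying over \<open>'k\<close> is the
  same as ``K is R or C''. Both of them are complete, so the class \<open>banach\<close> may be added to the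
  sort of \<open>'k\<close>.

  A statement about arbitrary Banach spaces \<open>E\<^sub>1, \<dots>, E\<^sub>d\<close> with \<open>d\<close> a variable cannot use the class
  \<open>banach\<close>, which would force all of them to be the same space. Banach spaces are therefore given by
  explicit carriers; the carriers of a finite family can always be placed in one common type.
\<close>

record ('k, 'a) nspace =
  carrier :: "'a set"
  add :: "'a \<Rightarrow> 'a \<Rightarrow> 'a"
  zero :: 'a
  scale :: "'k \<Rightarrow> 'a \<Rightarrow> 'a"
  nrm :: "'a \<Rightarrow> real"

text \<open>The value off the carrier only serves to meet the axioms of \<open>Metric_space\<close>, some of
  which are not relativised.\<close>

definition ndist :: "('k::real_normed_field, 'a) nspace \<Rightarrow> 'a \<Rightarrow> 'a \<Rightarrow> real" where
  "ndist X x y = (if x \<in> carrier X \<and> y \<in> carrier X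
     then nrm X (add X x (scale X (- 1) y)) else 0)"

abbreviation ntop :: "('k::real_normed_field, 'a) nspace \<Rightarrow> 'a topology" where
  "ntop X \<equiv> Metric_space.mtopology (carrier X) (ndist X)"

locale normed_space =
  fixes X :: "('k::real_normed_field, 'a) nspace"
  assumes zero_closed: "zero X \<in> carrier X"
    and add_closed: "\<lbrakk>x \<in> carrier X; y \<in> carrier X\<rbrakk> \<Longrightarrow> add X x y \<in> carrier X"
    and scale_closed: "x \<in> carrier X \<Longrightarrow> scale X c x \<in> carrier X"
    and add_assoc: "\<lbrakk>x \<in> carrier X; y \<in> carrier X; z \<in> carrier X\<rbrakk>
          \<Longrightarrow> add X (add X x y) z = add X x (add X y z)"
    and add_commute: "\<lbrakk>x \<in> carrier X; y \<in> carrier X\<rbrakk> \<Longrightarrow> add X x y = add X y x"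
    and add_zero: "x \<in> carrier X \<Longrightarrow> add X (zero X) x = x"
    and add_neg: "x \<in> carrier X \<Longrightarrow> add X x (scale X (- 1) x) = zero X"
    and scale_add: "\<lbrakk>x \<in> carrier X; y \<in> carrier X\<rbrakk>
          \<Longrightarrow> scale X c (add X x y) = add X (scale X c x) (scale X c y)"
    and add_scale: "x \<in> carrier X \<Longrightarrow> scale X (b + c) x = add X (scale X b x) (scale X c x)"
    and scale_scale: "x \<in> carrier X \<Longrightarrow> scale X b (scale X c x) = scale X (b * c) x"
    and scale_one: "x \<in> carrier X \<Longrightarrow> scale X 1 x = x"
    and nrm_eq_0: "x \<in> carrier X \<Longrightarrow> nrm X x = 0 \<longleftrightarrow> x = zero X"
    and nrm_scale: "x \<in> carrier X \<Longrightarrow> nrm X (scale X c x) = norm c * nrm X x"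
    and nrm_add: "\<lbrakk>x \<in> carrier X; y \<in> carrier X\<rbrakk> \<Longrightarrow> nrm X (add X x y) \<le> nrm X x + nrm X y"

locale banach_space = normed_space +
  assumes complete: "Metric_space.mcomplete (carrier X) (ndist X)"

lemma (in normed_space) Metric_space_ndist: "Metric_space (carrier X) (ndist X)"
proof -
  define m where "m = scale X (- 1)"
  have mc: "m x \<in> carrier X" if "x \<in> carrier X" for x
    using that by (simp add: m_def scale_closed)
  have nm: "nrm X (m x) = nrm X x" if "x \<in> carrier X" for x
    using that by (simp add: m_def nrm_scale)
  have mm: "m (m x) = x" if "x \<in> carrier X" for x
    using that by (simp add: m_def scale_scale scale_one)
  have madd: "m (add X x y) = add X (m x) (m y)" if "x \<in> carrier X" "y \<in> carrier X" for x y
    using that by (simp add: m_def scale_add)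
  have neg: "add X x (m x) = zero X" if "x \<in> carrier X" for x
    using that by (simp add: m_def add_neg)
  have cancel: "add X (m y) (add X y z) = z" if "y \<in> carrier X" "z \<in> carrier X" for y z
    using that by (metis add_assoc add_commute add_zero mc neg)
  have d: "ndist X x y = nrm X (add X x (m y))" if "x \<in> carrier X" "y \<in> carrier X" for x y
    using that by (simp add: ndist_def m_def)
  have nonneg: "0 \<le> nrm X x" if "x \<in> carrier X" for x
  proof -
    have "nrm X (add X x (m x)) = 0"
      using that by (simp add: neg nrm_eq_0 zero_closed)
    then show ?thesis
      using nrm_add[OF that mc[OF that]] nm[OF that] by simp
  qed
  show ?thesis
  proof
    show "0 \<le> ndist X x y" for x y
      by (simp add: ndist_def nonneg add_closed scale_closed)
    show "ndist X x y = ndist X y x" for x y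
    proof (cases "x \<in> carrier X \<and> y \<in> carrier X")
      case True
      then have "add X y (m x) = m (add X x (m y))"
        by (metis madd mm mc add_commute)
      with True show ?thesis
        by (simp add: d nm add_closed mc)
    qed (auto simp: ndist_def)
    show "ndist X x y = 0 \<longleftrightarrow> x = y" if xy: "x \<in> carrier X" "y \<in> carrier X" for x y
    proof -
      have "ndist X x y = 0 \<longleftrightarrow> add X x (m y) = zero X"
        using xy by (simp add: d nrm_eq_0 add_closed mc)
      also have "\<dots> \<longleftrightarrow> x = y"
        using xy by (metis add_assoc add_commute add_zero mc neg)
      finally show ?thesis .
    qed
    show "ndist X x z \<le> ndist X x y + ndist X y z"
      if "x \<in> carrier X" "y \<in> carrier X" "z \<in> carrier X" for x y z
    proof -
      have "add X x (m z) = add X (add X x (m y)) (add X y (m z))"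
        using that by (metis add_assoc add_closed cancel mc)
      then show ?thesis
        using that by (simp add: d nrm_add add_closed mc)
    qed
  qed
qed

definition scalar_space :: "('k::real_normed_field, 'k) nspace" where
  "scalar_space = \<lparr>carrier = UNIV, add = (+), zero = 0, scale = (*), nrm = norm\<rparr>"

lemma banach_space_scalar_space:
  "banach_space (scalar_space :: ('k::{real_normed_field, banach}, 'k) nspace)"
proof -
  interpret normed_space "scalar_space :: ('k, 'k) nspace"
    by unfold_locales (auto simp: scalar_space_def algebra_simps norm_mult norm_triangle_ineq)
  have "ndist (scalar_space :: ('k, 'k) nspace) = dist"
    by (intro ext) (simp add: ndist_def scalar_space_def dist_norm)
  moreover have "complete (UNIV :: 'k set)"
    by (rule complete_UNIV)
  ultimately have "Metric_space.mcomplete (carrier scalar_space) (ndist (scalar_space :: ('k, 'k) nspace))"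
    by (simp add: scalar_space_def)
  then show ?thesis
    by unfold_locales
qed


section \<open>Sequence spaces\<close>

text \<open>Sequences are indexed by the natural numbers starting from 0 instead of 1.\<close>

definition dual :: "('k::real_normed_field, 'a) nspace \<Rightarrow> ('a \<Rightarrow> 'k) set" where
  "dual X = {\<phi>. (\<forall>x\<in>carrier X. \<forall>y\<in>carrier X. \<phi> (add X x y) = \<phi> x + \<phi> y) \<and>
     (\<forall>c. \<forall>x\<in>carrier X. \<phi> (scale X c x) = c * \<phi> x) \<and>
     continuous_map (ntop X) euclidean \<phi>}"

definition dual_ball :: "('k::real_normed_field, 'a) nspace \<Rightarrow> ('a \<Rightarrow> 'k) set" where
  "dual_ball X = {\<phi> \<in> dual X. \<forall>x\<in>carrier X. norm (\<phi> x) \<le> nrm X x}"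

definition ell_weak :: "real \<Rightarrow> ('k::real_normed_field, 'a) nspace \<Rightarrow> (nat \<Rightarrow> 'a) set" where
  "ell_weak p X = {x. (\<forall>j. x j \<in> carrier X) \<and>
     (\<forall>\<phi>\<in>dual X. summable (\<lambda>j. norm (\<phi> (x j)) powr p))}"

definition weak_norm :: "real \<Rightarrow> ('k::real_normed_field, 'a) nspace \<Rightarrow> (nat \<Rightarrow> 'a) \<Rightarrow> real" where
  "weak_norm p X x = (SUP \<phi>\<in>dual_ball X. (\<Sum>j. norm (\<phi> (x j)) powr p) powr (1 / p))"

text \<open>
  An iterated sequence \<open>((a(n\<^sub>1,\<dots>,n\<^sub>k))\<^bsub>n\<^sub>k\<^esub> \<dots>)\<^bsub>n\<^sub>1\<^esub>\<close> is a function on lists, of which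
  only the values at the lists \<open>[n\<^sub>1,\<dots>,n\<^sub>k]\<close> of length \<open>k\<close> matter; fixing \<open>n\<^sub>1 = n\<close> gives
  \<open>\<lambda>ns. a (n # ns)\<close>. The first argument of \<open>ell_iter\<close> is the list of exponents
  \<open>[q\<^sub>1,\<dots>,q\<^sub>k]\<close>, outermost exponent first.
\<close>

primrec ell_iter_norm :: "real list \<Rightarrow> ('k, 'b) nspace \<Rightarrow> (nat list \<Rightarrow> 'b) \<Rightarrow> real" where
  "ell_iter_norm [] F a = nrm F (a [])"
| "ell_iter_norm (q # qs) F a =
     (\<Sum>n. ell_iter_norm qs F (\<lambda>ns. a (n # ns)) powr q) powr (1 / q)"

primrec ell_iter :: "real list \<Rightarrow> ('k, 'b) nspace \<Rightarrow> (nat list \<Rightarrow> 'b) set" where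
  "ell_iter [] F = {a. a [] \<in> carrier F}"
| "ell_iter (q # qs) F =
     {a. (\<forall>n. (\<lambda>ns. a (n # ns)) \<in> ell_iter qs F) \<and>
         summable (\<lambda>n. ell_iter_norm qs F (\<lambda>ns. a (n # ns)) powr q)}"


section \<open>Multilinear operators and blocks\<close>

text \<open>A \<open>d\<close>-tuple is an extensional function on \<open>{1..d}\<close>, and an operator is an extensional function
  on such tuples, so that equality of operators is equality of functions.\<close>

definition multilinear_ops ::
  "nat \<Rightarrow> (nat \<Rightarrow> ('k::real_normed_field, 'a) nspace) \<Rightarrow> ('k, 'b) nspace \<Rightarrow> ((nat \<Rightarrow> 'a) \<Rightarrow> 'b) set"
where
  "multilinear_ops d E F =
     {A \<in> (\<Pi>\<^sub>E r\<in>{1..d}. carrier (E r)) \<rightarrow>\<^sub>E carrier F.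
        \<forall>x \<in> (\<Pi>\<^sub>E r\<in>{1..d}. carrier (E r)). \<forall>r\<in>{1..d}. \<forall>u\<in>carrier (E r).
          (\<forall>v\<in>carrier (E r). A (x(r := add (E r) u v)) = add F (A (x(r := u))) (A (x(r := v)))) \<and>
          (\<forall>c. A (x(r := scale (E r) c u)) = scale F c (A (x(r := u))))}"

definition cont_multilinear_ops ::
  "nat \<Rightarrow> (nat \<Rightarrow> ('k::real_normed_field, 'a) nspace) \<Rightarrow> ('k, 'b) nspace \<Rightarrow> ((nat \<Rightarrow> 'a) \<Rightarrow> 'b) set"
where
  "cont_multilinear_ops d E F =
     {A \<in> multilinear_ops d E F.
        continuous_map (product_topology (\<lambda>r. ntop (E r)) {1..d}) (ntop F) A}"

definition ordered_partition :: "nat \<Rightarrow> nat \<Rightarrow> (nat \<Rightarrow> nat set) \<Rightarrow> bool" where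
  "ordered_partition d k I \<longleftrightarrow>
     (\<forall>s\<in>{1..k}. I s \<noteq> {}) \<and> disjoint_family_on I {1..k} \<and> (\<Union>s\<in>{1..k}. I s) = {1..d}"

definition part_of :: "nat \<Rightarrow> (nat \<Rightarrow> nat set) \<Rightarrow> nat \<Rightarrow> nat" where
  "part_of k I r = (THE s. s \<in> {1..k} \<and> r \<in> I s)"

text \<open>
  For a list \<open>ns = [n\<^sub>1,\<dots>,n\<^sub>k]\<close>, \<open>block_point k I ns\<close> is the point
  \<open>(n\<^bsub>s(1)\<^esub>, \<dots>, n\<^bsub>s(d)\<^esub>)\<close> of the block \<open>B\<^sub>I\<close>, and the block itself is the set of
  these points; \<open>n\<^sub>s\<close> is \<open>ns ! (s - 1)\<close> because list positions start at 0.
\<close>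

definition block_point :: "nat \<Rightarrow> (nat \<Rightarrow> nat set) \<Rightarrow> nat list \<Rightarrow> nat \<Rightarrow> nat" where
  "block_point k I ns r = ns ! (part_of k I r - 1)"

definition block_tuple ::
  "nat \<Rightarrow> nat \<Rightarrow> (nat \<Rightarrow> nat set) \<Rightarrow> (nat \<Rightarrow> nat \<Rightarrow> 'a) \<Rightarrow> nat list \<Rightarrow> nat \<Rightarrow> 'a" where
  "block_tuple d k I x ns = (\<lambda>r\<in>{1..d}. x r (block_point k I ns r))"


section \<open>Partially multiple summing operators\<close>

definition epowr :: "ennreal \<Rightarrow> real \<Rightarrow> ennreal" where
  "epowr x t = (if x = top then top else ennreal (enn2real x powr t))"

text \<open>
  With \<open>qs = [q\<^sub>1,\<dots>,q\<^sub>k]\<close>, \<open>nested_sum 1 qs F a\<close> is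
  \<open>(\<Sum>\<^bsub>n\<^sub>1\<^esub> (\<dots> (\<Sum>\<^bsub>n\<^sub>k\<^esub> \<parallel>a(n\<^sub>1,\<dots>,n\<^sub>k)\<parallel> ^ q\<^sub>k) ^ (q\<^bsub>k-1\<^esub> / q\<^sub>k) \<dots>) ^ (q\<^sub>1 / q\<^sub>2)) ^ (1 / q\<^sub>1)\<close>,
  computed in \<open>[0,\<infinity>]\<close>. The argument \<open>e\<close> is the numerator of the exponent put on the current sum.
\<close>

primrec nested_sum :: "real list \<Rightarrow> real \<Rightarrow> ('k, 'b) nspace \<Rightarrow> (nat list \<Rightarrow> 'b) \<Rightarrow> ennreal" where
  "nested_sum [] e F a = ennreal (nrm F (a []) powr e)"
| "nested_sum (q # qs) e F a = epowr (\<Sum>n. nested_sum qs q F (\<lambda>ns. a (n # ns))) (e / q)"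

abbreviation exponents :: "nat \<Rightarrow> (nat \<Rightarrow> real) \<Rightarrow> real list" where
  "exponents k q \<equiv> map q [1..<Suc k]"

definition summing_bound ::
  "nat \<Rightarrow> nat \<Rightarrow> (nat \<Rightarrow> nat set) \<Rightarrow> (nat \<Rightarrow> real) \<Rightarrow> (nat \<Rightarrow> real) \<Rightarrow>
   (nat \<Rightarrow> ('k::real_normed_field, 'a) nspace) \<Rightarrow> ('k, 'b) nspace \<Rightarrow>
   ((nat \<Rightarrow> 'a) \<Rightarrow> 'b) \<Rightarrow> real \<Rightarrow> bool"
where
  "summing_bound d k I p q E F A C \<longleftrightarrow>
     (\<forall>x. (\<forall>r\<in>{1..d}. x r \<in> ell_weak (p r) (E r)) \<longrightarrow>
        nested_sum (exponents k q) 1 F (\<lambda>ns. A (block_tuple d k I x ns))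
          \<le> ennreal (C * (\<Prod>r\<in>{1..d}. weak_norm (p r) (E r) (x r))))"

definition partially_summing_ops ::
  "nat \<Rightarrow> nat \<Rightarrow> (nat \<Rightarrow> nat set) \<Rightarrow> (nat \<Rightarrow> real) \<Rightarrow> (nat \<Rightarrow> real) \<Rightarrow>
   (nat \<Rightarrow> ('k::real_normed_field, 'a) nspace) \<Rightarrow> ('k, 'b) nspace \<Rightarrow> ((nat \<Rightarrow> 'a) \<Rightarrow> 'b) set"
where
  "partially_summing_ops d k I p q E F =
     {A \<in> multilinear_ops d E F. \<exists>C>0. summing_bound d k I p q E F A C}"

definition partially_summing_norm ::
  "nat \<Rightarrow> nat \<Rightarrow> (nat \<Rightarrow> nat set) \<Rightarrow> (nat \<Rightarrow> real) \<Rightarrow> (nat \<Rightarrow> real) \<Rightarrow>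
   (nat \<Rightarrow> ('k::real_normed_field, 'a) nspace) \<Rightarrow> ('k, 'b) nspace \<Rightarrow> ((nat \<Rightarrow> 'a) \<Rightarrow> 'b) \<Rightarrow> real"
where
  "partially_summing_norm d k I p q E F A = Inf {C. C > 0 \<and> summing_bound d k I p q E F A C}"


section \<open>Block-summing operators and compatibility\<close>

definition block_summing_ops ::
  "nat \<Rightarrow> nat \<Rightarrow> (nat \<Rightarrow> nat set) \<Rightarrow> (nat \<Rightarrow> real) \<Rightarrow> (nat \<Rightarrow> real) \<Rightarrow>
   (nat \<Rightarrow> ('k::real_normed_field, 'a) nspace) \<Rightarrow> ('k, 'b) nspace \<Rightarrow> ((nat \<Rightarrow> 'a) \<Rightarrow> 'b) set"
where
  "block_summing_ops d k I p q E F =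
     {A \<in> cont_multilinear_ops d E F.
        \<forall>x. (\<forall>r\<in>{1..d}. x r \<in> ell_weak (p r) (E r)) \<longrightarrow>
          (\<lambda>ns. A (block_tuple d k I x ns)) \<in> ell_iter (exponents k q) F}"

text \<open>The usual operator norm of the induced operator: the supremum over the product of the closed
  unit balls of the spaces of weakly summable sequences.\<close>

definition block_summing_norm ::
  "nat \<Rightarrow> nat \<Rightarrow> (nat \<Rightarrow> nat set) \<Rightarrow> (nat \<Rightarrow> real) \<Rightarrow> (nat \<Rightarrow> real) \<Rightarrow>
   (nat \<Rightarrow> ('k::real_normed_field, 'a) nspace) \<Rightarrow> ('k, 'b) nspace \<Rightarrow> ((nat \<Rightarrow> 'a) \<Rightarrow> 'b) \<Rightarrow> real"
where
  "block_summing_norm d k I p q E F A =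
     (SUP x \<in> {x. \<forall>r\<in>{1..d}. x r \<in> ell_weak (p r) (E r) \<and> weak_norm (p r) (E r) (x r) \<le> 1}.
        ell_iter_norm (exponents k q) F (\<lambda>ns. A (block_tuple d k I x ns)))"

definition block_compatible ::
  "'k::real_normed_field itself \<Rightarrow> nat \<Rightarrow> nat \<Rightarrow> (nat \<Rightarrow> nat set) \<Rightarrow>
   (nat \<Rightarrow> real) \<Rightarrow> (nat \<Rightarrow> real) \<Rightarrow> bool"
where
  "block_compatible K d k I p q \<longleftrightarrow>
     (\<forall>x :: nat \<Rightarrow> nat \<Rightarrow> 'k. (\<forall>r\<in>{1..d}. x r \<in> ell_weak (p r) scalar_space) \<longrightarrow>
        (let a = (\<lambda>ns. \<Prod>s\<in>{1..k}. \<Prod>r\<in>I s. x r (ns ! (s - 1))) in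
           a \<in> ell_iter (exponents k q) scalar_space \<and>
           ell_iter_norm (exponents k q) scalar_space a
             \<le> (\<Prod>r\<in>{1..d}. weak_norm (p r) scalar_space (x r))))"

end

theory Submission
  imports Defs
begin

text \<open>
  Evaluating a summing inequality at sequences with a single nonzero entry shows that the operator is
  bounded, hence continuous. For the converse inclusion a uniform bound on the unit ball of weakly
  summable tuples is needed: if there were none, geometrically scaled bad tuples could be interleaved
  into one weakly summable tuple with infinite mixed sum. By homogeneity the bounds on the unit ball
  are exactly the summing constants, which gives the equality of norms. That weak norms are finite is
  the uniform boundedness principle on the dual space, proved by a sign-choosing argument.

  For compatibility, mixed norms of product sequences factor over the blocks, so the claim is Hoelder's
  inequality in each block; necessity is seen on indicators of one or two points.
\<close>

section \<open>Mixed sums in the extended half-line\<close>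

text \<open>Two obstacles shape the proof. First, \<open>weak_norm\<close> is a supremum of reals
  and bounds nothing unless the set is known to be bounded, so uniform boundedness over the dual
  ball has to precede every argument with unit balls. The signs are chosen one step at a time, and
  the steps shrink by a factor 9, so that all the steps after a given one together amount to an
  eighth of it and cannot undo what it has gained. Second, the sets of operators ask for different
  things: one inequality with a common constant, against mere membership for each tuple. Both are
  therefore expressed by a single mixed sum with values in [0,infinity], which exists for every
  tuple: a uniform bound on the ball in one case, pointwise finiteness in the other. In passing from
  the latter to the former, scaling by 2^-m acts on all \<open>d\<close> coordinates at once and
  costs 2^-(m d), so the bad tuples must beat m 2^(m d) for a surplus of m to survive.\<close>

lemma epowr_ennreal: "0 \<le> r \<Longrightarrow> epowr (ennreal r) t = ennreal (r powr t)"
  by (simp add: epowr_def)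

lemma epowr_mono:
  assumes "x \<le> y" "0 \<le> t"
  shows "epowr x t \<le> epowr y t"
proof (cases "y = top")
  case False
  with assms have "x \<noteq> top"
    by (auto simp: top_unique)
  with False assms show ?thesis
    by (auto simp: epowr_def less_top intro!: ennreal_leI powr_mono2 enn2real_mono)
qed (simp add: epowr_def)

lemma epowr_cmult:
  assumes "0 < c"
  shows "epowr (ennreal c * x) t = ennreal (c powr t) * epowr x t"
proof (cases x)
  case (real r)
  then have "epowr (ennreal c * x) t = ennreal ((c * r) powr t)"
    using assms by (simp add: epowr_ennreal flip: ennreal_mult)
  also have "\<dots> = ennreal (c powr t) * epowr x t"
    using real by (simp add: epowr_ennreal powr_mult ennreal_mult)
  finally show ?thesis .
next
  case top
  with assms show ?thesis
    by (simp add: epowr_def ennreal_mult_top)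
qed

lemma suminf_ennreal_reindex_le:
  fixes f :: "nat \<Rightarrow> ennreal"
  assumes "inj h"
  shows "(\<Sum>n. f (h n)) \<le> (\<Sum>n. f n)"
proof (rule suminf_le_const[OF summableI])
  fix n
  have "(\<Sum>i<n. f (h i)) = sum f (h ` {..<n})"
    using assms by (subst sum.reindex) (auto simp: inj_on_def)
  also have "\<dots> \<le> suminf f"
    by (rule sum_le_suminf) auto
  finally show "(\<Sum>i<n. f (h i)) \<le> suminf f" .
qed

text \<open>The same injection \<open>h\<close> acts on every level, because all indices of a block
  run through the same interleaved sequence. Restricting to the image of \<open>h\<close> only
  discards nonnegative terms, level by level.\<close>

lemma nested_sum_reindex_le:
  assumes "\<forall>t\<in>set qs. 0 < t" "0 \<le> e" "inj h"
    and "\<And>ns. length ns = length qs \<Longrightarrow> 0 \<le> nrm G (b ns) \<and> nrm G (b ns) \<le> nrm F (a (map h ns))"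
  shows "nested_sum qs e G b \<le> nested_sum qs e F a"
  using assms
proof (induction qs arbitrary: e a b)
  case Nil
  then show ?case
    by (auto intro!: ennreal_leI powr_mono2)
next
  case (Cons t qs)
  have "(\<Sum>n. nested_sum qs t G (\<lambda>ns. b (n # ns))) \<le> (\<Sum>n. nested_sum qs t F (\<lambda>ns. a (h n # ns)))"
  proof (intro suminf_le summableI Cons.IH)
    fix n and ns :: "nat list"
    assume "length ns = length qs"
    then show "0 \<le> nrm G (b (n # ns)) \<and> nrm G (b (n # ns)) \<le> nrm F (a (h n # map h ns))"
      using Cons.prems(4)[of "n # ns"] by simp
  qed (use Cons.prems in auto)
  also have "\<dots> \<le> (\<Sum>n. nested_sum qs t F (\<lambda>ns. a (n # ns)))"
    using \<open>inj h\<close> by (rule suminf_ennreal_reindex_le)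
  finally show ?case
    using Cons.prems by (auto intro: epowr_mono)
qed

text \<open>At a level with exponent \<open>t\<close> the inner sums carry the factor
  \<open>c powr t\<close>, and the power \<open>e / t\<close> turns it into \<open>c powr e\<close>;
  this is why the induction runs over all \<open>e\<close>.\<close>

lemma nested_sum_cmult:
  assumes "\<forall>t\<in>set qs. 0 < t" "0 < c"
    and "\<And>ns. length ns = length qs \<Longrightarrow> nrm G (b ns) = c * nrm F (a ns)"
  shows "nested_sum qs e G b = ennreal (c powr e) * nested_sum qs e F a"
  using assms
proof (induction qs arbitrary: e a b)
  case Nil
  then show ?case
    by (simp add: powr_mult ennreal_mult)
next
  case (Cons t qs)
  have "nested_sum qs t G (\<lambda>ns. b (n # ns)) = ennreal (c powr t) * nested_sum qs t F (\<lambda>ns. a (n # ns))" for n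
    using Cons.prems by (intro Cons.IH) auto
  moreover have "0 < t" "0 < c powr t"
    using Cons.prems by auto
  moreover from \<open>0 < t\<close> have "(c powr t) powr (e / t) = c powr e"
    unfolding powr_powr by simp
  ultimately show ?case
    by (simp add: epowr_cmult)
qed

text \<open>Keeping only the term with all indices 0 is enough to recover the value of an operator
  at a single point.\<close>

lemma nested_sum_ge_term:
  assumes "\<forall>t\<in>set qs. 0 < t" "0 \<le> e"
  shows "ennreal (nrm F (a (replicate (length qs) 0)) powr e) \<le> nested_sum qs e F a"
  using assms
proof (induction qs arbitrary: e a)
  case (Cons t qs)
  let ?v = "nrm F (a (replicate (length (t # qs)) 0)) powr t"
  have "ennreal ?v \<le> nested_sum qs t F (\<lambda>ns. a (0 # ns))"
    using Cons.IH[of t "\<lambda>ns. a (0 # ns)"] Cons.prems by simp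
  also have "\<dots> \<le> (\<Sum>n. nested_sum qs t F (\<lambda>ns. a (n # ns)))"
    using sum_le_suminf[OF summableI, of "{0}" "\<lambda>n. nested_sum qs t F (\<lambda>ns. a (n # ns))"] by simp
  finally have "epowr (ennreal ?v) (e / t) \<le> nested_sum (t # qs) e F a"
    using Cons.prems by (auto intro: epowr_mono)
  then show ?case
    using Cons.prems by (simp add: epowr_ennreal powr_powr)
qed simp

text \<open>The two encodings of a mixed norm differ in where roots are taken:
  \<open>nested_sum\<close> merges the root of one level with the power of the enclosing level. They
  agree for \<open>e = 1\<close>, but the induction needs \<open>e\<close> to be the exponent of the
  enclosing level.\<close>

lemma nested_sum_eq_ell_iter_norm:
  assumes "\<forall>t\<in>set qs. 0 < t" "a \<in> ell_iter qs F"
  shows "nested_sum qs e F a = ennreal (ell_iter_norm qs F a powr e)"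
  using assms
proof (induction qs arbitrary: e a)
  case (Cons t qs)
  let ?f = "\<lambda>n. ell_iter_norm qs F (\<lambda>ns. a (n # ns)) powr t"
  have "nested_sum qs t F (\<lambda>ns. a (n # ns)) = ennreal (?f n)" for n
    using Cons by auto
  moreover have "(\<Sum>n. ennreal (?f n)) = ennreal (suminf ?f)"
    using Cons.prems by (intro suminf_ennreal2) auto
  moreover have "0 \<le> suminf ?f"
    using Cons.prems by (intro suminf_nonneg) auto
  ultimately show ?case
    using Cons.prems by (simp add: epowr_ennreal powr_powr)
qed simp

text \<open>\<open>epowr\<close> keeps top at top whatever the exponent, so a finite total forces
  the sum at every level, and each of its terms, to be finite.\<close>

lemma ell_iter_if_nested_sum_finite:
  assumes "\<forall>t\<in>set qs. 0 < t" "nested_sum qs e F a < top"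
    and "\<And>ns. length ns = length qs \<Longrightarrow> a ns \<in> nspace.carrier F"
  shows "a \<in> ell_iter qs F"
  using assms
proof (induction qs arbitrary: e a)
  case (Cons t qs)
  let ?g = "\<lambda>n. nested_sum qs t F (\<lambda>ns. a (n # ns))"
  have fin: "suminf ?g < top"
    using Cons.prems(2) by (auto simp: epowr_def less_top[symmetric] split: if_splits)
  have mem: "(\<lambda>ns. a (n # ns)) \<in> ell_iter qs F" for n
  proof (rule Cons.IH)
    show "?g n < top"
      using fin by (rule ennreal_suminf_lessD)
  qed (use Cons.prems in auto)
  have "?g n = ennreal (ell_iter_norm qs F (\<lambda>ns. a (n # ns)) powr t)" for n
    using Cons.prems mem by (intro nested_sum_eq_ell_iter_norm) auto
  with fin have "summable (\<lambda>n. ell_iter_norm qs F (\<lambda>ns. a (n # ns)) powr t)"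
    by (intro summable_suminf_not_top) auto
  with mem show ?case
    by simp
qed simp

lemma ell_iter_norm_nonneg:
  assumes "a \<in> ell_iter qs F" "\<And>y. y \<in> nspace.carrier F \<Longrightarrow> 0 \<le> nrm F y"
  shows "0 \<le> ell_iter_norm qs F a"
  using assms by (cases qs) auto

section \<open>Dual space and weakly summable sequences\<close>

context normed_space
begin

lemma nrm_nonneg: "x \<in> carrier X \<Longrightarrow> 0 \<le> nrm X x"
  using nrm_add[of x "scale X (- 1) x"]
  by (simp add: add_neg scale_closed nrm_scale nrm_eq_0[THEN iffD2] zero_closed)

lemma nrm_zero: "nrm X (zero X) = 0"
  using nrm_eq_0 zero_closed by blast

lemma scale_zero: "scale X c (zero X) = zero X"
  using nrm_eq_0[of "scale X c (zero X)"] by (simp add: nrm_scale nrm_zero scale_closed zero_closed)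

lemma diff_add_cancel:
  "\<lbrakk>x \<in> carrier X; y \<in> carrier X\<rbrakk> \<Longrightarrow> add X (add X x (scale X (- 1) y)) y = x"
  by (metis add_assoc add_commute add_neg add_zero scale_closed)

lemma dualI:
  assumes "\<And>x y. \<lbrakk>x \<in> carrier X; y \<in> carrier X\<rbrakk> \<Longrightarrow> \<phi> (add X x y) = \<phi> x + \<phi> y"
    and "\<And>c x. x \<in> carrier X \<Longrightarrow> \<phi> (scale X c x) = c * \<phi> x"
    and bd: "\<And>x. x \<in> carrier X \<Longrightarrow> norm (\<phi> x) \<le> B * nrm X x"
  shows "\<phi> \<in> dual X"
proof -
  interpret Metric_space "carrier X" "ndist X"
    by (rule Metric_space_ndist)
  \<comment> \<open>\<open>B\<close> may fail to be positive, while the modulus of continuity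
    \<open>e / B'\<close> needs a positive divisor.\<close>
  define B' where "B' = max B 1"
  have bd': "norm (\<phi> x) \<le> B' * nrm X x" if "x \<in> carrier X" for x
    using bd[OF that] mult_right_mono[OF max.cobounded1[of B 1] nrm_nonneg[OF that]]
    by (simp add: B'_def)
  have "B' > 0"
    by (simp add: B'_def)
  have "continuous_map mtopology euclidean \<phi>"
    unfolding metric_continuous_map[OF Met_TC.Metric_space_axioms, simplified]
  proof (intro ballI allI impI)
    fix a and e :: real
    assume a: "a \<in> carrier X" and "0 < e"
    have "dist (\<phi> a) (\<phi> x) < e" if x: "x \<in> carrier X" "ndist X a x < e / B'" for x
    proof -
      let ?d = "add X a (scale X (- 1) x)"
      have d: "?d \<in> carrier X" "\<phi> ?d = \<phi> a - \<phi> x" "nrm X ?d = ndist X a x"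
        using a x assms by (auto simp: ndist_def add_closed scale_closed)
      then have "dist (\<phi> a) (\<phi> x) \<le> B' * ndist X a x"
        using bd'[of ?d] by (simp add: dist_norm)
      also have "\<dots> < e"
        using x \<open>B' > 0\<close> by (simp add: field_simps)
      finally show ?thesis .
    qed
    then show "\<exists>\<delta>>0. \<forall>x. x \<in> carrier X \<and> ndist X a x < \<delta> \<longrightarrow> dist (\<phi> a) (\<phi> x) < e"
      using \<open>0 < e\<close> \<open>0 < B'\<close> by (metis divide_pos_pos)
  qed
  with assms show ?thesis
    by (auto simp: dual_def)
qed

lemma dual_bounded:
  assumes "\<phi> \<in> dual X"
  obtains B where "0 < B" "\<And>x. x \<in> carrier X \<Longrightarrow> norm (\<phi> x) \<le> B * nrm X x"
proof -
  interpret Metric_space "carrier X" "ndist X"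
    by (rule Metric_space_ndist)
  have lin: "\<And>c x. x \<in> carrier X \<Longrightarrow> \<phi> (scale X c x) = c * \<phi> x"
    using assms by (auto simp: dual_def)
  have \<phi>0: "\<phi> (zero X) = 0"
    using lin[of "zero X" 0] by (simp add: scale_zero zero_closed)
  have "continuous_map mtopology euclidean \<phi>"
    using assms by (auto simp: dual_def)
  then obtain \<delta> where "\<delta> > 0"
    and \<delta>: "\<And>x. \<lbrakk>x \<in> carrier X; ndist X (zero X) x < \<delta>\<rbrakk> \<Longrightarrow> dist (\<phi> (zero X)) (\<phi> x) < 1"
    unfolding metric_continuous_map[OF Met_TC.Metric_space_axioms, simplified]
    using zero_closed zero_less_one by blast
  have nd: "ndist X (zero X) x = nrm X x" if "x \<in> carrier X" for x
    using that by (simp add: ndist_def zero_closed add_zero scale_closed nrm_scale)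
  show thesis
  proof
    show "0 < 2 / \<delta>"
      using \<open>\<delta> > 0\<close> by simp
    fix x assume x: "x \<in> carrier X"
    show "norm (\<phi> x) \<le> 2 / \<delta> * nrm X x"
    proof (cases "nrm X x = 0")
      case True
      with x have "x = zero X"
        using nrm_eq_0 by blast
      then show ?thesis
        by (simp add: \<phi>0 nrm_zero)
    next
      case False
      then have pos: "0 < nrm X x"
        using nrm_nonneg[OF x] by simp
      \<comment> \<open>The scaled vector has norm \<open>\<delta> / 2\<close>, inside the ball on
        which \<open>\<phi>\<close> stays below 1; hence the constant
        \<open>2 / \<delta>\<close>.\<close>
      define t where "t = \<delta> / (2 * nrm X x)"
      have "t > 0"
        using pos \<open>\<delta> > 0\<close> by (simp add: t_def)
      have "nrm X (scale X (of_real t) x) < \<delta>"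
      proof -
        have "nrm X (scale X (of_real t) x) = t * nrm X x"
          using x \<open>t > 0\<close> by (simp add: nrm_scale)
        then show ?thesis
          using pos \<open>\<delta> > 0\<close> by (simp add: t_def)
      qed
      then have "norm (\<phi> (scale X (of_real t) x)) < 1"
        using \<delta>[of "scale X (of_real t) x"] x by (simp add: nd scale_closed \<phi>0 dist_norm)
      then have "t * norm (\<phi> x) < 1"
        using x \<open>t > 0\<close> by (simp add: lin norm_mult)
      then show ?thesis
        using pos \<open>\<delta> > 0\<close> by (simp add: t_def field_simps)
    qed
  qed
qed

text \<open>Weak summability speaks of all functionals, the weak norm only of the unit ball;
  rescaling carries estimates from the ball to the whole dual.\<close>

lemma dual_rescale:
  assumes "\<phi> \<in> dual X"
  obtains c where "0 < c" "(\<lambda>x. of_real c * \<phi> x) \<in> dual_ball X"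
proof -
  obtain B where B: "0 < B" "\<And>x. x \<in> carrier X \<Longrightarrow> norm (\<phi> x) \<le> B * nrm X x"
    using dual_bounded[OF assms] by blast
  have le: "norm (of_real (1 / B) * \<phi> x) \<le> nrm X x" if "x \<in> carrier X" for x
    using B(1) B(2)[OF that] by (simp add: norm_mult norm_divide field_simps)
  then have "(\<lambda>x. of_real (1 / B) * \<phi> x) \<in> dual X"
    using assms by (intro dualI[where B = 1]) (auto simp: dual_def algebra_simps)
  with le B show thesis
    by (intro that[of "1 / B"]) (auto simp: dual_ball_def)
qed

lemma zero_in_dual_ball: "(\<lambda>x. 0) \<in> dual_ball X"
  by (auto simp: dual_ball_def nrm_nonneg intro!: dualI[where B = 1])

end

section \<open>Uniform boundedness of weak sums over the dual ball\<close>

lemma powr_add_le: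
  fixes a b :: real
  assumes "0 \<le> a" "0 \<le> b" "0 \<le> t"
  shows "(a + b) powr t \<le> 2 powr t * (a powr t + b powr t)"
proof -
  have "(a + b) powr t \<le> (2 * max a b) powr t"
    using assms by (intro powr_mono2) auto
  also have "\<dots> = 2 powr t * max a b powr t"
    by (rule powr_mult)
  also have "\<dots> \<le> 2 powr t * (a powr t + b powr t)"
    by (intro mult_left_mono) (auto simp: max_def)
  finally show ?thesis .
qed

text \<open>Since \<open>v\<close> is half the difference of \<open>u + v\<close> and
  \<open>u - v\<close>, one of the two has norm at least that of \<open>v\<close>. This is the
  source of the sign choice: one sign keeps half of the step's own sum, whatever was built
  before.\<close>

lemma powr_norm_le_sum_diff:
  fixes u v :: "'k::real_normed_vector"
  assumes "0 \<le> t"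
  shows "norm v powr t \<le> norm (u + v) powr t + norm (u - v) powr t"
proof -
  have "2 * norm v = norm ((u + v) - (u - v))"
    by (simp flip: scaleR_2)
  also have "\<dots> \<le> norm (u + v) + norm (u - v)"
    by (rule norm_triangle_ineq4)
  finally have "norm v \<le> norm (u + v) \<or> norm v \<le> norm (u - v)"
    by linarith
  then show ?thesis
    using powr_mono2[OF assms norm_ge_zero] powr_ge_zero
    by (meson add_increasing add_increasing2)
qed

context normed_space
begin

lemma in_dual_ball_divide:
  assumes "\<phi> \<in> dual X" "0 < B" "\<And>x. x \<in> carrier X \<Longrightarrow> norm (\<phi> x) \<le> B * nrm X x"
  shows "(\<lambda>x. \<phi> x / of_real B) \<in> dual_ball X"
proof -
  have le: "norm (\<phi> x / of_real B) \<le> nrm X x" if "x \<in> carrier X" for x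
    using assms(2) assms(3)[OF that] by (simp add: norm_divide field_simps)
  then have "(\<lambda>x. \<phi> x / of_real B) \<in> dual X"
    using assms(1) by (intro dualI[where B = 1]) (auto simp: dual_def add_divide_distrib)
  with le show ?thesis
    by (auto simp: dual_ball_def)
qed

end

text \<open>Stands in for completeness of the dual space: an absolutely convergent series of
  functionals converges pointwise because the scalar field is complete, and its sum is again
  bounded.\<close>

lemma dual_ball_series:
  fixes X :: "('k::{real_normed_field, banach}, 'a) nspace"
  assumes "normed_space X" and \<phi>: "\<And>l. \<phi> l \<in> dual_ball X"
    and c: "\<And>l. norm (c l) \<le> a l" and a: "a sums A"
  shows summable_dual_ball_series: "y \<in> nspace.carrier X \<Longrightarrow> summable (\<lambda>l. c l * \<phi> l y)"
    and norm_dual_ball_series_le: "y \<in> nspace.carrier X \<Longrightarrow> norm (\<Sum>l. c l * \<phi> l y) \<le> A * nrm X y"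
    and dual_ball_series_in_dual: "(\<lambda>y. \<Sum>l. c l * \<phi> l y) \<in> dual X"
proof -
  interpret normed_space X by fact
  have tm: "norm (c l * \<phi> l y) \<le> a l * nrm X y" if "y \<in> nspace.carrier X" for l y
    using \<phi>[of l] that c[of l] order_trans[OF norm_ge_zero c]
    by (auto simp: dual_ball_def norm_mult nrm_nonneg intro!: mult_mono)
  have sums: "(\<lambda>l. a l * nrm X y) sums (A * nrm X y)" for y
    using a by (rule sums_mult2)
  show sm: "summable (\<lambda>l. c l * \<phi> l y)" if "y \<in> nspace.carrier X" for y
    by (rule summable_comparison_test'[OF sums_summable[OF sums]]) (use tm that in auto)
  show bd: "norm (\<Sum>l. c l * \<phi> l y) \<le> A * nrm X y" if "y \<in> nspace.carrier X" for y
    using norm_suminf_le[OF tm[OF that] sums_summable[OF sums]] sums_unique[OF sums, of y] by simp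
  show "(\<lambda>y. \<Sum>l. c l * \<phi> l y) \<in> dual X"
  proof (rule dualI[OF _ _ bd])
    fix x y assume xy: "x \<in> nspace.carrier X" "y \<in> nspace.carrier X"
    have "\<phi> l (add X x y) = \<phi> l x + \<phi> l y" for l
      using \<phi>[of l] xy by (auto simp: dual_ball_def dual_def)
    then show "(\<Sum>l. c l * \<phi> l (add X x y)) = (\<Sum>l. c l * \<phi> l x) + (\<Sum>l. c l * \<phi> l y)"
      using xy by (simp add: suminf_add sm algebra_simps)
  next
    fix b x assume x: "x \<in> nspace.carrier X"
    have "\<phi> l (scale X b x) = b * \<phi> l x" for l
      using \<phi>[of l] x by (auto simp: dual_ball_def dual_def)
    then show "(\<Sum>l. c l * \<phi> l (scale X b x)) = b * (\<Sum>l. c l * \<phi> l x)"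
      using suminf_mult[OF sm[OF x], of b] by (simp add: algebra_simps)
  qed
qed

text \<open>Of the two perturbations \<open>\<psi> \<plusminus> 9\<^sup>-\<^sup>m \<phi>\<^sub>m\<close> one has a large partial sum; choosing the sign
  accordingly at every step leads to a limit functional whose weak sum is infinite.\<close>

lemma weak_partial_sums_bounded:
  fixes X :: "('k::{real_normed_field, banach}, 'a) nspace"
  assumes X: "normed_space X" and p: "1 \<le> p" and x: "x \<in> ell_weak p X"
  shows "\<exists>B. \<forall>\<phi>\<in>dual_ball X. \<forall>N. (\<Sum>j<N. norm (\<phi> (x j)) powr p) \<le> B"
proof (rule ccontr)
  assume unbounded: "\<nexists>B. \<forall>\<phi>\<in>dual_ball X. \<forall>N. (\<Sum>j<N. norm (\<phi> (x j)) powr p) \<le> B"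
  interpret normed_space X by fact
  have xc: "x j \<in> nspace.carrier X" for j
    using x by (auto simp: ell_weak_def)
  define G where "G N \<phi> = (\<Sum>j<N. norm (\<phi> (x j)) powr p)" for N and \<phi> :: "'a \<Rightarrow> 'k"
  define S where "S N = (SUP \<phi>\<in>dual_ball X. G N \<phi>)" for N
  \<comment> \<open>Steps of size 9^-m leave a tail of total size 9^-m / 8 after step
    \<open>m\<close>. In p-th powers the factor 9^-m becomes \<open>1 / r ^ m\<close>.\<close>
  define r where "r = 9 powr p"
  have "r > 0"
    by (simp add: r_def)
  have r_pow: "((1 / 9) ^ m) powr p = 1 / r ^ m" for m
    by (simp add: r_def powr_divide power_one_over powr_power powr_powr mult.commute flip: powr_realpow)
  have G_mult: "G N (\<lambda>y. c * \<phi> y) = norm c powr p * G N \<phi>" for N c \<phi>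
    by (simp add: G_def norm_mult powr_mult sum_distrib_left)
  have "bdd_above (G N ` dual_ball X)" for N
  proof (rule bdd_aboveI2)
    fix \<phi> assume "\<phi> \<in> dual_ball X"
    then show "G N \<phi> \<le> (\<Sum>j<N. nrm X (x j) powr p)"
      using p xc unfolding G_def by (intro sum_mono powr_mono2) (auto simp: dual_ball_def)
  qed
  then have G_le: "G N \<phi> \<le> S N" if "\<phi> \<in> dual_ball X" for N \<phi>
    using that by (auto simp: S_def intro: cSUP_upper)
  \<comment> \<open>\<open>N\<close> is taken so large that the supremum outgrows the shrinking
    factor \<open>1 / r ^ m\<close>. The functional nearly attains that supremum, because the tail
    will be controlled only through \<open>S N\<close> and must be comparable with the step.\<close>
  have "\<exists>N \<phi>. \<phi> \<in> dual_ball X \<and> real m * r ^ m < S N \<and> 3 / 4 * S N < G N \<phi>" for m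
  proof -
    obtain \<phi> N where "\<phi> \<in> dual_ball X" "real m * r ^ m < G N \<phi>"
      using unbounded[unfolded not_ex, rule_format, of "real m * r ^ m"] by (auto simp: G_def not_le)
    with G_le have S: "real m * r ^ m < S N"
      by (meson less_le_trans)
    moreover have "0 \<le> real m * r ^ m"
      using \<open>r > 0\<close> by simp
    ultimately have "3 / 4 * S N < S N"
      by linarith
    then obtain \<phi>' where "\<phi>' \<in> dual_ball X" "3 / 4 * S N < G N \<phi>'"
      using less_cSUP_iff[OF _ \<open>bdd_above (G N ` dual_ball X)\<close>, of "3 / 4 * S N"] zero_in_dual_ball
      by (auto simp: S_def)
    with S show ?thesis
      by blast
  qed
  then obtain N \<phi> where \<phi>: "\<And>m. \<phi> m \<in> dual_ball X" and S_gt: "\<And>m. real m * r ^ m < S (N m)"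
    and G_gt: "\<And>m. 3 / 4 * S (N m) < G (N m) (\<phi> m)"
    by metis
  have "\<exists>\<psi>. \<forall>m. (m = 0 \<longrightarrow> \<psi> m = (\<lambda>y. 0)) \<and> (\<exists>c. norm c = (1 / 9) ^ m \<and>
      \<psi> (Suc m) = (\<lambda>y. \<psi> m y + c * \<phi> m y) \<and> G (N m) (\<phi> m) / r ^ m \<le> 2 * G (N m) (\<psi> (Suc m)))"
  proof (rule dependent_nat_choice)
    fix \<psi> :: "'a \<Rightarrow> 'k" and m
    define c :: 'k where "c = of_real ((1 / 9) ^ m)"
    have nc: "norm c = (1 / 9) ^ m"
      by (simp add: c_def norm_power norm_divide)
    have "G (N m) (\<phi> m) / r ^ m = G (N m) (\<lambda>y. c * \<phi> m y)"
      by (simp add: G_mult nc r_pow)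
    also have "\<dots> \<le> G (N m) (\<lambda>y. \<psi> y + c * \<phi> m y) + G (N m) (\<lambda>y. \<psi> y - c * \<phi> m y)"
      using p unfolding G_def sum.distrib[symmetric] by (intro sum_mono powr_norm_le_sum_diff) auto
    finally have "G (N m) (\<phi> m) / r ^ m \<le> 2 * G (N m) (\<lambda>y. \<psi> y + c * \<phi> m y) \<or>
        G (N m) (\<phi> m) / r ^ m \<le> 2 * G (N m) (\<lambda>y. \<psi> y + (- c) * \<phi> m y)"
      by simp linarith
    then show "\<exists>\<psi>'. (Suc m = 0 \<longrightarrow> \<psi>' = (\<lambda>y. 0)) \<and> (\<exists>c. norm c = (1 / 9) ^ m \<and>
      \<psi>' = (\<lambda>y. \<psi> y + c * \<phi> m y) \<and> G (N m) (\<phi> m) / r ^ m \<le> 2 * G (N m) \<psi>')"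
      using nc by (metis nat.distinct(1) norm_minus_cancel)
  qed auto
  then obtain \<psi> where \<psi>0: "\<psi> 0 = (\<lambda>y. 0)" and step: "\<forall>m. \<exists>c. norm c = (1 / 9) ^ m \<and>
      \<psi> (Suc m) = (\<lambda>y. \<psi> m y + c * \<phi> m y) \<and> G (N m) (\<phi> m) / r ^ m \<le> 2 * G (N m) (\<psi> (Suc m))"
    by blast
  from choice[OF step] obtain c where nc: "\<And>m. norm (c m) = (1 / 9) ^ m"
    and \<psi>Suc: "\<And>m. \<psi> (Suc m) = (\<lambda>y. \<psi> m y + c m * \<phi> m y)"
    and G\<psi>: "\<And>m. G (N m) (\<phi> m) / r ^ m \<le> 2 * G (N m) (\<psi> (Suc m))"
    by blast
  have \<psi>: "\<psi> m y = (\<Sum>l<m. c l * \<phi> l y)" for m y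
    by (induction m) (auto simp: \<psi>0 \<psi>Suc)
  define L where "L y = (\<Sum>l. c l * \<phi> l y)" for y
  have geom: "(\<lambda>l. (1 / 9) ^ (l + m)) sums ((1 / 9) ^ m * (9 / 8) :: real)" for m
    using sums_mult[OF geometric_sums[of "1 / 9 :: real"], of "(1 / 9) ^ m"]
    by (simp add: power_add mult.commute)
  have "L \<in> dual X"
    unfolding L_def using nc geom[of 0] by (intro dual_ball_series_in_dual[OF X \<phi>]) auto
  then have sm: "summable (\<lambda>j. norm (L (x j)) powr p)"
    using x by (auto simp: ell_weak_def)
  define T where "T = (\<Sum>j. norm (L (x j)) powr p)"
  \<comment> \<open>Write s for \<open>S (N m) / r ^ m\<close>. The step yields at least 3/4 s, of
    which the tail accounts for at most s / 2, so s / 4 is at most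
    \<open>2 * (2 powr p * T)\<close>, while s is at least \<open>m\<close>.\<close>
  have bound: "real m \<le> 8 * 2 powr p * T" for m
  proof -
    \<comment> \<open>The part of the series after step \<open>m\<close>, so that
      \<open>\<psi> (Suc m)\<close> is \<open>L - R\<close> at the vectors \<open>x j\<close>; once
      \<open>R\<close> is shown to be small there, a large partial sum must come from
      \<open>L\<close>.\<close>
    define R where "R y = (\<Sum>l. c (l + Suc m) * \<phi> (l + Suc m) y)" for y
    have tail: "norm (c (l + Suc m)) \<le> (1 / 9) ^ (l + Suc m)" for l
      by (simp add: nc)
    note tail_facts = X \<phi> tail geom[of "Suc m"]
    have "R \<in> dual X"
      unfolding R_def by (rule dual_ball_series_in_dual[OF tail_facts])
    moreover have "norm (R y) \<le> (1 / 9) ^ m / 8 * nrm X y" if "y \<in> nspace.carrier X" for y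
      using norm_dual_ball_series_le[OF tail_facts that] by (simp add: R_def)
    ultimately have "(\<lambda>y. R y / of_real ((1 / 9) ^ m / 8)) \<in> dual_ball X"
      by (intro in_dual_ball_divide) auto
    then have "G (N m) (\<lambda>y. R y / of_real ((1 / 9) ^ m / 8)) \<le> S (N m)"
      by (rule G_le)
    moreover have "G (N m) R = G (N m) (\<lambda>y. of_real ((1 / 9) ^ m / 8) * (R y / of_real ((1 / 9) ^ m / 8)))"
      by simp
    ultimately have "G (N m) R \<le> ((1 / 9) ^ m / 8) powr p * S (N m)"
      unfolding G_mult by (simp add: norm_mult norm_divide norm_power mult_left_mono)
    then have GR: "G (N m) R \<le> S (N m) / (r ^ m * 8 powr p)"
      by (simp add: powr_divide r_pow)
    have split: "\<psi> (Suc m) (x j) = L (x j) - R (x j)" for j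
    proof -
      have "summable (\<lambda>l. c l * \<phi> l (x j))"
        using nc geom[of 0] xc by (intro summable_dual_ball_series[OF X \<phi>]) auto
      then show ?thesis
        using suminf_split_initial_segment[of "\<lambda>l. c l * \<phi> l (x j)" "Suc m"]
        by (simp add: \<psi> L_def R_def)
    qed
    have "G (N m) (\<psi> (Suc m)) \<le> 2 powr p * (G (N m) L + G (N m) R)"
      unfolding G_def sum.distrib[symmetric] sum_distrib_left
    proof (rule sum_mono)
      fix j
      have "norm (\<psi> (Suc m) (x j)) powr p \<le> (norm (L (x j)) + norm (R (x j))) powr p"
        using p by (intro powr_mono2) (auto simp: split norm_triangle_ineq4)
      then show "norm (\<psi> (Suc m) (x j)) powr p \<le> 2 powr p * (norm (L (x j)) powr p + norm (R (x j)) powr p)"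
        using powr_add_le[of "norm (L (x j))" "norm (R (x j))" p] p by simp
    qed
    also have "\<dots> \<le> 2 powr p * (T + S (N m) / (r ^ m * 8 powr p))"
      using GR sum_le_suminf[OF sm, of "{..<N m}"]
      by (intro mult_left_mono add_mono) (auto simp: G_def T_def)
    also have "\<dots> = 2 powr p * T + 2 powr p * (S (N m) / (r ^ m * 8 powr p))"
      by (rule distrib_left)
    \<comment> \<open>Split 8 as 2 * 4: the 2 cancels the constant of \<open>powr_add_le\<close>,
      and \<open>4 powr p\<close> is at least 4 because \<open>p\<close> is at least 1.\<close>
    also have "2 powr p * (S (N m) / (r ^ m * 8 powr p)) \<le> S (N m) / r ^ m / 4"
    proof -
      have "(8 :: real) powr p = 2 powr p * 4 powr p"
        by (simp flip: powr_mult)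
      moreover have "4 \<le> (4 :: real) powr p"
        using p powr_mono[of 1 p 4] by simp
      moreover have "0 \<le> S (N m)"
        using S_gt[of m] \<open>r > 0\<close> by (smt (verit) mult_nonneg_nonneg of_nat_0_le_iff zero_le_power)
      ultimately show ?thesis
        using \<open>r > 0\<close> by (simp add: frac_le mult.commute)
    qed
    finally have "2 * G (N m) (\<psi> (Suc m)) \<le> 2 * (2 powr p * T) + S (N m) / r ^ m / 2"
      by simp
    with G\<psi>[of m] have "G (N m) (\<phi> m) / r ^ m \<le> 2 * (2 powr p * T) + S (N m) / r ^ m / 2"
      by linarith
    moreover have "3 / 4 * S (N m) / r ^ m \<le> G (N m) (\<phi> m) / r ^ m"
      using G_gt[of m] \<open>r > 0\<close> by (intro divide_right_mono) auto
    moreover have "real m \<le> S (N m) / r ^ m"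
      using S_gt[of m] \<open>r > 0\<close> by (simp add: field_simps)
    ultimately show ?thesis
      by simp
  qed
  obtain m :: nat where "8 * 2 powr p * T < real m"
    using reals_Archimedean2 by blast
  with bound[of m] show False
    by simp
qed


text \<open>Passes from partial sums to full series; every later use of \<open>weak_norm\<close> as
  an upper bound rests on this.\<close>

lemma bdd_above_weak_sums:
  fixes X :: "('k::{real_normed_field, banach}, 'a) nspace"
  assumes "normed_space X" "1 \<le> p" "x \<in> ell_weak p X"
  shows "bdd_above ((\<lambda>\<phi>. (\<Sum>j. norm (\<phi> (x j)) powr p) powr (1 / p)) ` dual_ball X)"
proof -
  obtain B where B: "\<And>\<phi> N. \<phi> \<in> dual_ball X \<Longrightarrow> (\<Sum>j<N. norm (\<phi> (x j)) powr p) \<le> B"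
    using weak_partial_sums_bounded[OF assms] by blast
  show ?thesis
  proof (rule bdd_aboveI2)
    fix \<phi> assume \<phi>: "\<phi> \<in> dual_ball X"
    then have "summable (\<lambda>j. norm (\<phi> (x j)) powr p)"
      using assms by (auto simp: ell_weak_def dual_ball_def)
    then show "(\<Sum>j. norm (\<phi> (x j)) powr p) powr (1 / p) \<le> B powr (1 / p)"
      using assms B[OF \<phi>] by (intro powr_mono2 suminf_le_const suminf_nonneg) auto
  qed
qed

lemma weak_norm_upper:
  fixes X :: "('k::{real_normed_field, banach}, 'a) nspace"
  assumes "normed_space X" "1 \<le> p" "x \<in> ell_weak p X" "\<phi> \<in> dual_ball X"
  shows "(\<Sum>j. norm (\<phi> (x j)) powr p) powr (1 / p) \<le> weak_norm p X x"
  unfolding weak_norm_def by (rule cSUP_upper[OF assms(4) bdd_above_weak_sums[OF assms(1-3)]])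

lemma weak_norm_nonneg:
  fixes X :: "('k::{real_normed_field, banach}, 'a) nspace"
  assumes "normed_space X" "1 \<le> p" "x \<in> ell_weak p X"
  shows "0 \<le> weak_norm p X x"
  by (rule order_trans[OF powr_ge_zero weak_norm_upper[OF assms normed_space.zero_in_dual_ball[OF assms(1)]]])

lemma weak_sum_le_weak_norm_powr:
  fixes X :: "('k::{real_normed_field, banach}, 'a) nspace"
  assumes "normed_space X" "1 \<le> p" "x \<in> ell_weak p X" "\<phi> \<in> dual_ball X"
  shows "(\<Sum>j. norm (\<phi> (x j)) powr p) \<le> weak_norm p X x powr p"
proof -
  have "0 \<le> (\<Sum>j. norm (\<phi> (x j)) powr p)"
    using assms by (intro suminf_nonneg) (auto simp: ell_weak_def dual_ball_def)
  then have "(\<Sum>j. norm (\<phi> (x j)) powr p) = ((\<Sum>j. norm (\<phi> (x j)) powr p) powr (1 / p)) powr p"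
    using assms by (simp add: powr_powr)
  also have "\<dots> \<le> weak_norm p X x powr p"
    using assms by (intro powr_mono2 weak_norm_upper) auto
  finally show ?thesis .
qed

section \<open>Scaled, one-term and interleaved weakly summable sequences\<close>

lemma weak_norm_le:
  assumes "normed_space X"
    and "\<And>\<phi>. \<phi> \<in> dual_ball X \<Longrightarrow> (\<Sum>j. norm (\<phi> (x j)) powr p) powr (1 / p) \<le> B"
  shows "weak_norm p X x \<le> B"
  unfolding weak_norm_def
  using normed_space.zero_in_dual_ball[OF assms(1)] by (intro cSUP_least assms(2)) auto

lemma scale_in_ell_weak:
  assumes "normed_space X" "x \<in> ell_weak p X"
  shows "(\<lambda>j. scale X c (x j)) \<in> ell_weak p X"
proof -
  have "summable (\<lambda>j. norm (\<phi> (scale X c (x j))) powr p)" if "\<phi> \<in> dual X" for \<phi>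
  proof -
    have "norm (\<phi> (scale X c (x j))) powr p = norm c powr p * norm (\<phi> (x j)) powr p" for j
      using that assms(2) by (auto simp: dual_def ell_weak_def norm_mult powr_mult)
    then show ?thesis
      using that assms(2) by (simp add: ell_weak_def summable_mult)
  qed
  with assms show ?thesis
    by (auto simp: ell_weak_def normed_space.scale_closed)
qed

lemma weak_norm_scale_le:
  fixes X :: "('k::{real_normed_field, banach}, 'a) nspace"
  assumes "normed_space X" "1 \<le> p" "x \<in> ell_weak p X"
  shows "weak_norm p X (\<lambda>j. scale X c (x j)) \<le> norm c * weak_norm p X x"
proof (rule weak_norm_le[OF assms(1)])
  fix \<phi> assume \<phi>: "\<phi> \<in> dual_ball X"
  have "norm (\<phi> (scale X c (x j))) powr p = norm c powr p * norm (\<phi> (x j)) powr p" for j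
    using \<phi> assms(3) by (auto simp: dual_ball_def dual_def ell_weak_def norm_mult powr_mult)
  moreover have "summable (\<lambda>j. norm (\<phi> (x j)) powr p)"
    using \<phi> assms(3) by (auto simp: ell_weak_def dual_ball_def)
  ultimately have "(\<Sum>j. norm (\<phi> (scale X c (x j))) powr p) powr (1 / p)
      = norm c * (\<Sum>j. norm (\<phi> (x j)) powr p) powr (1 / p)"
    using assms(2) by (simp add: suminf_mult powr_mult powr_powr)
  also have "\<dots> \<le> norm c * weak_norm p X x"
    using weak_norm_upper[OF assms \<phi>] by (intro mult_left_mono) auto
  finally show "(\<Sum>j. norm (\<phi> (scale X c (x j))) powr p) powr (1 / p) \<le> norm c * weak_norm p X x" .
qed

lemma single_in_ell_weak:
  assumes "normed_space X" "u \<in> nspace.carrier X" "1 \<le> p"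
  shows "(\<lambda>j. if j = i then u else zero X) \<in> ell_weak p X"
    and "weak_norm p X (\<lambda>j. if j = i then u else zero X) \<le> nrm X u"
proof -
  interpret normed_space X by fact
  have eq: "(\<lambda>j. norm (\<phi> (if j = i then u else zero X)) powr p)
      = (\<lambda>j. if j = i then norm (\<phi> u) powr p else 0)" if "\<phi> \<in> dual X" for \<phi>
  proof -
    have "\<phi> (scale X 0 (zero X)) = 0 * \<phi> (zero X)"
      using that zero_closed unfolding dual_def by blast
    then show ?thesis
      by (auto simp: scale_zero)
  qed
  show "(\<lambda>j. if j = i then u else zero X) \<in> ell_weak p X"
    using assms by (auto simp: ell_weak_def eq zero_closed)
  show "weak_norm p X (\<lambda>j. if j = i then u else zero X) \<le> nrm X u"
  proof (rule weak_norm_le[OF assms(1)])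
    fix \<phi> assume \<phi>: "\<phi> \<in> dual_ball X"
    then have "(\<Sum>j. norm (\<phi> (if j = i then u else zero X)) powr p) = norm (\<phi> u) powr p"
      using sums_unique[OF sums_single[of i "\<lambda>_. norm (\<phi> u) powr p"]] by (simp add: eq dual_ball_def)
    then show "(\<Sum>j. norm (\<phi> (if j = i then u else zero X)) powr p) powr (1 / p) \<le> nrm X u"
      using \<phi> assms by (simp add: powr_powr dual_ball_def)
  qed
qed

text \<open>Against a fixed functional the m-th scaled copy has p-sum at most a constant times 2^-m,
  so the copies together stay below a geometric series.\<close>

lemma interleave_in_ell_weak:
  fixes X :: "('k::{real_normed_field, banach}, 'a) nspace"
  assumes X: "normed_space X" and p: "1 \<le> p"
    and x: "\<And>m. x m \<in> ell_weak p X" "\<And>m. weak_norm p X (x m) \<le> 1"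
  shows "(\<lambda>n. case prod_decode n of (m, j) \<Rightarrow> scale X (of_real ((1 / 2) ^ m)) (x m j)) \<in> ell_weak p X"
    (is "?y \<in> _")
proof -
  interpret normed_space X by fact
  have xc: "x m j \<in> nspace.carrier X" for m j
    using x(1)[of m] by (auto simp: ell_weak_def)
  have "summable (\<lambda>n. norm (\<phi> (?y n)) powr p)" if \<phi>: "\<phi> \<in> dual X" for \<phi>
  proof (rule summable_suminf_not_top)
    obtain c where c: "0 < c" "(\<lambda>x. of_real c * \<phi> x) \<in> dual_ball X"
      using dual_rescale[OF \<phi>] by blast
    \<comment> \<open>Working in [0,infinity] allows the sum along \<open>prod_decode\<close> to be
      rearranged into a double sum before any convergence is known.\<close>
    define f where "f = (\<lambda>(m, j). ennreal (norm (\<phi> (scale X (of_real ((1 / 2) ^ m)) (x m j))) powr p))"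
    have block: "(\<Sum>j. f (m, j)) \<le> ennreal ((1 / c) powr p * (1 / 2) ^ m)" for m
    proof -
      have sm: "summable (\<lambda>j. norm (\<phi> (x m j)) powr p)"
        using x(1) \<phi> by (auto simp: ell_weak_def)
      have "(\<Sum>j. norm (of_real c * \<phi> (x m j)) powr p) \<le> weak_norm p X (x m) powr p"
        by (rule weak_sum_le_weak_norm_powr[OF X p x(1) c(2)])
      also have "\<dots> \<le> 1"
        using p x(2)[of m] weak_norm_nonneg[OF X p x(1)] powr_mono2[of p "weak_norm p X (x m)" 1] by simp
      finally have "c powr p * (\<Sum>j. norm (\<phi> (x m j)) powr p) \<le> 1"
        using c(1) sm by (simp add: norm_mult powr_mult suminf_mult)
      then have le: "(\<Sum>j. norm (\<phi> (x m j)) powr p) \<le> (1 / c) powr p"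
        using c(1) by (simp add: powr_divide field_simps)
      \<comment> \<open>For a base in [0,1] an exponent \<open>p\<close> of at least 1 only
        decreases the value, so the ratio 1/2 serves for all \<open>p\<close>.\<close>
      have "((1 / 2 :: real) ^ m) powr p \<le> ((1 / 2) ^ m) powr 1"
        using p by (intro powr_mono') (auto simp: power_le_one)
      then have pw: "((1 / 2 :: real) ^ m) powr p \<le> (1 / 2) ^ m"
        by simp
      have "(\<Sum>j. f (m, j)) = (\<Sum>j. ennreal (((1 / 2) ^ m) powr p * norm (\<phi> (x m j)) powr p))"
        using \<phi> xc by (auto simp: f_def dual_def norm_mult norm_power norm_divide powr_mult)
      also have "\<dots> = ennreal (((1 / 2) ^ m) powr p * (\<Sum>j. norm (\<phi> (x m j)) powr p))"
        using sm by (subst suminf_ennreal2) (auto simp: summable_mult suminf_mult)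
      also have "\<dots> \<le> ennreal ((1 / 2) ^ m * (1 / c) powr p)"
        using le pw sm by (intro ennreal_leI mult_mono suminf_nonneg) auto
      finally show ?thesis
        by (simp add: mult.commute)
    qed
    have "(\<Sum>n. ennreal (norm (\<phi> (?y n)) powr p)) = (\<Sum>n. f (prod_decode n))"
      by (auto simp: f_def case_prod_beta)
    also have "\<dots> = (\<Sum>m. \<Sum>j. f (m, j))"
      by (rule suminf_ennreal_2dimen) simp
    also have "\<dots> \<le> (\<Sum>m. ennreal ((1 / c) powr p * (1 / 2) ^ m))"
      by (intro suminf_le summableI block)
    also have "\<dots> < top"
      unfolding less_top[symmetric] by (intro ennreal_suminf_neq_top summable_mult) auto
    finally show "(\<Sum>n. ennreal (norm (\<phi> (?y n)) powr p)) \<noteq> top"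
      by simp
  qed simp
  with xc show ?thesis
    by (auto simp: ell_weak_def scale_closed split: prod.split)
qed

section \<open>Ordered partitions\<close>

lemma ordered_partition_unique:
  assumes "ordered_partition d k I" "s \<in> {1..k}" "s' \<in> {1..k}" "r \<in> I s" "r \<in> I s'"
  shows "s = s'"
  using assms unfolding ordered_partition_def disjoint_family_on_def by blast

lemma ordered_partition_subset:
  assumes "ordered_partition d k I" "s \<in> {1..k}"
  shows "I s \<subseteq> {1..d}"
  using assms unfolding ordered_partition_def by blast

lemma part_of_in:
  assumes "ordered_partition d k I" "r \<in> {1..d}"
  shows "part_of k I r \<in> {1..k}"
proof -
  have "r \<in> (\<Union>s\<in>{1..k}. I s)"
    using assms by (simp only: ordered_partition_def)
  then obtain s where s: "s \<in> {1..k}" "r \<in> I s"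
    by blast
  have "s' = s" if "s' \<in> {1..k} \<and> r \<in> I s'" for s'
    using ordered_partition_unique[OF assms(1)] s that by blast
  then have "part_of k I r = s"
    unfolding part_of_def using s by (intro the_equality) auto
  with s show ?thesis
    by simp
qed

text \<open>Reindexing all block indices by \<open>h\<close> amounts to reindexing the sequences.
  The length condition keeps every position that is read inside the list.\<close>

lemma block_tuple_map:
  assumes "ordered_partition d k I" "length ns = k"
  shows "block_tuple d k I x (map h ns) = block_tuple d k I (\<lambda>r j. x r (h j)) ns"
proof -
  have "part_of k I r - 1 < length ns" if "r \<in> {1..d}" for r
    using part_of_in[OF assms(1) that] assms(2) by auto
  then show ?thesis
    by (auto simp: block_tuple_def block_point_def)
qed

section \<open>Multilinear operators\<close>

locale multilinear_op =
  fixes d :: nat and E :: "nat \<Rightarrow> ('k::real_normed_field, 'a) nspace" and F :: "('k, 'b) nspace" and A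
  assumes normed_E: "\<And>r. r \<in> {1..d} \<Longrightarrow> normed_space (E r)"
    and normed_F: "normed_space F"
    and multilinear: "A \<in> multilinear_ops d E F"
begin

abbreviation tuples where "tuples \<equiv> \<Pi>\<^sub>E r\<in>{1..d}. nspace.carrier (E r)"

lemma op_closed: "x \<in> tuples \<Longrightarrow> A x \<in> nspace.carrier F"
  using multilinear by (auto simp: multilinear_ops_def)

lemma op_add:
  assumes "x \<in> tuples" "r \<in> {1..d}" "u \<in> nspace.carrier (E r)" "v \<in> nspace.carrier (E r)"
  shows "A (x(r := add (E r) u v)) = add F (A (x(r := u))) (A (x(r := v)))"
  using multilinear assms unfolding multilinear_ops_def by blast

lemma op_scale:
  assumes "x \<in> tuples" "r \<in> {1..d}" "u \<in> nspace.carrier (E r)"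
  shows "A (x(r := scale (E r) c u)) = scale F c (A (x(r := u)))"
  using multilinear assms unfolding multilinear_ops_def by blast

lemma upd_tuples: "\<lbrakk>x \<in> tuples; r \<in> {1..d}; u \<in> nspace.carrier (E r)\<rbrakk> \<Longrightarrow> x(r := u) \<in> tuples"
  by (auto simp: PiE_def Pi_def extensional_def)

lemma nrm_op_scale_all:
  assumes x: "x \<in> tuples"
  shows "nrm F (A (\<lambda>r\<in>{1..d}. scale (E r) (c r) (x r))) = (\<Prod>r\<in>{1..d}. norm (c r)) * nrm F (A x)"
proof -
  \<comment> \<open>Coordinates in \<open>S\<close> are already scaled, the others are not;
    induction on \<open>S\<close> changes one slot at a time, as multilinearity requires.\<close>
  define z where "z S = (\<lambda>r\<in>{1..d}. if r \<in> S then scale (E r) (c r) (x r) else x r)" for S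
  have zt: "z S \<in> tuples" for S
    unfolding z_def restrict_PiE_iff
    using PiE_mem[OF x] normed_space.scale_closed[OF normed_E] by simp
  have "nrm F (A (z S)) = (\<Prod>r\<in>S. norm (c r)) * nrm F (A x)" if "S \<subseteq> {1..d}" for S
    using finite_subset[OF that finite_atLeastAtMost] that
  proof (induction S rule: finite_induct)
    case empty
    have "z {} = x"
      using x by (auto simp: z_def fun_eq_iff PiE_def extensional_def)
    then show ?case
      by simp
  next
    case (insert r S)
    then have r: "r \<in> {1..d}" "x r \<in> nspace.carrier (E r)"
      using x by auto
    have "z (insert r S) = (z S)(r := scale (E r) (c r) (x r))" "z S = (z S)(r := x r)"
      using r insert.hyps by (auto simp: z_def fun_eq_iff)
    then have "A (z (insert r S)) = scale F (c r) (A (z S))"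
      using op_scale[OF zt r, of S "c r"] by simp
    then show ?case
      using insert op_closed[OF zt[of S]] by (simp add: normed_space.nrm_scale[OF normed_F])
  qed
  from this[of "{1..d}"] show ?thesis
    by (simp add: z_def cong: restrict_cong)
qed

text \<open>Telescoping: \<open>x\<close> is changed into \<open>y\<close> one coordinate at a time,
  and by additivity each change costs the value of \<open>A\<close> with the difference in that
  slot, which the bound makes at most \<open>C * K ^ (d - 1) * \<delta>\<close>.\<close>

lemma ndist_op_le:
  assumes x: "x \<in> tuples" and y: "y \<in> tuples" and C: "0 \<le> C"
    and bound: "\<And>x. x \<in> tuples \<Longrightarrow> nrm F (A x) \<le> C * (\<Prod>r\<in>{1..d}. nrm (E r) (x r))"
    and K: "1 \<le> K" "\<And>r. r \<in> {1..d} \<Longrightarrow> nrm (E r) (x r) \<le> K" "\<And>r. r \<in> {1..d} \<Longrightarrow> nrm (E r) (y r) \<le> K"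
    and \<delta>: "\<And>r. r \<in> {1..d} \<Longrightarrow> ndist (E r) (x r) (y r) \<le> \<delta>"
  shows "ndist F (A x) (A y) \<le> real d * (C * K ^ d * \<delta>)"
proof -
  interpret F: normed_space F
    by (rule normed_F)
  interpret FM: Metric_space "nspace.carrier F" "ndist F"
    by (rule F.Metric_space_ndist)
  define z where "z S = (\<lambda>r\<in>{1..d}. if r \<in> S then y r else x r)" for S
  have zt: "z S \<in> tuples" for S
    unfolding z_def restrict_PiE_iff using PiE_mem[OF x] PiE_mem[OF y] by simp
  have "ndist F (A x) (A (z S)) \<le> real (card S) * (C * K ^ d * \<delta>)" if "S \<subseteq> {1..d}" for S
    using finite_subset[OF that finite_atLeastAtMost] that
  proof (induction S rule: finite_induct)
    case empty
    have "z {} = x"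
      using x by (auto simp: z_def fun_eq_iff PiE_def extensional_def)
    then show ?case
      using op_closed[OF x] by simp
  next
    case (insert r S)
    then have r: "r \<in> {1..d}"
      by simp
    interpret Er: normed_space "E r"
      by (rule normed_E[OF r])
    interpret ErM: Metric_space "nspace.carrier (E r)" "ndist (E r)"
      by (rule Er.Metric_space_ndist)
    define u where "u = add (E r) (y r) (scale (E r) (- 1) (x r))"
    have xr: "x r \<in> nspace.carrier (E r)" and yr: "y r \<in> nspace.carrier (E r)"
      using x y r by auto
    then have u: "u \<in> nspace.carrier (E r)" "add (E r) u (x r) = y r" "nrm (E r) u = ndist (E r) (x r) (y r)"
      using ErM.commute[of "x r" "y r"]
      by (auto simp: u_def Er.add_closed Er.scale_closed Er.diff_add_cancel ndist_def)
    have "z (insert r S) = (z S)(r := y r)" "z S = (z S)(r := x r)"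
      using r insert.hyps by (auto simp: z_def fun_eq_iff)
    then have zr: "A (z (insert r S)) = add F (A ((z S)(r := u))) (A (z S))"
      using op_add[OF zt r u(1) xr, of S] u(2) by simp
    have ut: "(z S)(r := u) \<in> tuples"
      using zt r u(1) by (rule upd_tuples)
    have Azu: "A ((z S)(r := u)) \<in> nspace.carrier F" and Az: "A (z S) \<in> nspace.carrier F"
      and Ax: "A x \<in> nspace.carrier F"
      by (rule op_closed[OF ut], rule op_closed[OF zt], rule op_closed[OF x])
    have zr': "A (z (insert r S)) \<in> nspace.carrier F"
      using Azu Az zr F.add_closed by simp
    have \<delta>0: "0 \<le> \<delta>"
      using \<delta>[OF r] ErM.nonneg order_trans by blast
    have "ndist F (A (z (insert r S))) (A (z S)) = nrm F (A ((z S)(r := u)))"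
      using Azu Az zr' by (simp add: ndist_def zr F.add_assoc F.scale_closed F.add_neg)
        (metis F.add_commute F.add_zero F.zero_closed)
    also have "\<dots> \<le> C * (\<Prod>i\<in>{1..d}. nrm (E i) (((z S)(r := u)) i))"
      using ut by (rule bound)
    also have "\<dots> \<le> C * (\<Prod>i\<in>{1..d}. if i = r then \<delta> else K)"
    proof (intro mult_left_mono prod_mono conjI)
      fix i assume i: "i \<in> {1..d}"
      show "0 \<le> nrm (E i) (((z S)(r := u)) i)"
        by (rule normed_space.nrm_nonneg[OF normed_E[OF i] PiE_mem[OF ut i]])
      show "nrm (E i) (((z S)(r := u)) i) \<le> (if i = r then \<delta> else K)"
        using i K \<delta>[OF r] u(3) by (auto simp: z_def)
    qed (rule C)
    also have "(\<Prod>i\<in>{1..d}. if i = r then \<delta> else K) = \<delta> * K ^ (d - 1)"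
    proof -
      have "(\<Prod>i\<in>{1..d} - {r}. if i = r then \<delta> else K) = (\<Prod>i\<in>{1..d} - {r}. K)"
        by (rule prod.cong) auto
      with r show ?thesis
        by (subst prod.remove[of _ r]) auto
    qed
    \<comment> \<open>As \<open>K\<close> is at least 1, the full power \<open>K ^ d\<close> may be
      used, which spares the truncated \<open>d - 1\<close> in the statement.\<close>
    also have "C * (\<delta> * K ^ (d - 1)) \<le> C * (\<delta> * K ^ d)"
      using C \<delta>0 K(1) by (intro mult_left_mono power_increasing) auto
    finally have "ndist F (A (z S)) (A (z (insert r S))) \<le> C * K ^ d * \<delta>"
      by (simp add: FM.commute mult_ac)
    moreover have "ndist F (A x) (A (z (insert r S))) \<le> ndist F (A x) (A (z S)) + ndist F (A (z S)) (A (z (insert r S)))"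
      using Ax Az zr' by (rule FM.triangle)
    ultimately show ?case
      using insert by (simp add: distrib_right)
  qed
  moreover have "z {1..d} = y"
    using y by (auto simp: z_def fun_eq_iff PiE_def extensional_def)
  ultimately show ?thesis
    by (metis card_atLeastAtMost diff_Suc_1 order_refl)
qed

lemma cont_multilinear_if_bounded:
  assumes C: "0 \<le> C"
    and bound: "\<And>x. x \<in> tuples \<Longrightarrow> nrm F (A x) \<le> C * (\<Prod>r\<in>{1..d}. nrm (E r) (x r))"
  shows "A \<in> cont_multilinear_ops d E F"
proof -
  interpret FM: Metric_space "nspace.carrier F" "ndist F"
    by (rule normed_space.Metric_space_ndist[OF normed_F])
  note EM = normed_space.Metric_space_ndist[OF normed_E]
  let ?X = "product_topology (\<lambda>r. ntop (E r)) {1..d}"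
  have tops: "topspace ?X = tuples"
    using Metric_space.topspace_mtopology[OF EM] by (auto simp: PiE_iff)
  have "continuous_map ?X FM.mtopology A"
    unfolding FM.continuous_map_to_metric
  proof (intro ballI allI impI)
    fix x and e :: real
    assume "x \<in> topspace ?X" and e: "0 < e"
    then have x: "x \<in> tuples"
      by (simp only: tops)
    \<comment> \<open>\<open>K\<close> exceeds the norm of every coordinate of \<open>x\<close> by
      at least 1, so it also bounds every \<open>y\<close> whose coordinates are within
      \<open>\<delta>\<close>, at most 1, of those of \<open>x\<close>.\<close>
    define K where "K = 1 + (\<Sum>r\<in>{1..d}. nrm (E r) (x r))"
    have nx: "0 \<le> nrm (E r) (x r)" if "r \<in> {1..d}" for r
      using x that by (intro normed_space.nrm_nonneg[OF normed_E]) auto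
    have xK: "nrm (E r) (x r) + 1 \<le> K" if "r \<in> {1..d}" for r
      using member_le_sum[of r "{1..d}" "\<lambda>r. nrm (E r) (x r)"] nx that by (simp add: K_def)
    have "0 \<le> (\<Sum>r\<in>{1..d}. nrm (E r) (x r))"
      by (rule sum_nonneg[OF nx])
    then have K1: "1 \<le> K"
      by (simp add: K_def)
    define M where "M = real d * (C * K ^ d)"
    have M: "0 \<le> M"
      using C K1 by (simp add: M_def)
    \<comment> \<open>\<open>M\<close> can be 0; the summand 1 keeps the divisor positive and makes
      \<open>M * \<delta>\<close> strictly smaller than \<open>e\<close>.\<close>
    define \<delta> where "\<delta> = min 1 (e / (M + 1))"
    have \<delta>: "0 < \<delta>" "\<delta> \<le> 1" "M * \<delta> < e"
    proof -
      show "0 < \<delta>" "\<delta> \<le> 1"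
        using e M by (auto simp: \<delta>_def)
      have "M * \<delta> \<le> M * (e / (M + 1))"
        using M by (intro mult_left_mono) (auto simp: \<delta>_def)
      also have "\<dots> < e"
        using M e by (simp add: field_simps)
      finally show "M * \<delta> < e" .
    qed
    define U where "U = (\<Pi>\<^sub>E r\<in>{1..d}. Metric_space.mball (nspace.carrier (E r)) (ndist (E r)) (x r) \<delta>)"
    have "openin ?X U"
      unfolding U_def openin_PiE[OF finite_atLeastAtMost] by (blast intro: Metric_space.openin_mball[OF EM])
    moreover have "x \<in> U"
      using x \<delta>(1) Metric_space.centre_in_mball_iff[OF EM] by (auto simp: U_def PiE_iff)
    moreover have "A y \<in> FM.mball (A x) e" if "y \<in> U" for y
    proof -
      have yt: "y \<in> tuples" and yd: "\<And>r. r \<in> {1..d} \<Longrightarrow> ndist (E r) (x r) (y r) < \<delta>"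
        using that Metric_space.in_mball[OF EM] by (auto simp: U_def PiE_iff)
      have "nrm (E r) (y r) \<le> K" if r: "r \<in> {1..d}" for r
      proof -
        interpret Er: normed_space "E r"
          by (rule normed_E[OF r])
        have mem: "x r \<in> nspace.carrier (E r)" "y r \<in> nspace.carrier (E r)"
          using x yt r by auto
        let ?u = "add (E r) (y r) (scale (E r) (- 1) (x r))"
        have "nrm (E r) (y r) \<le> nrm (E r) ?u + nrm (E r) (x r)"
          using Er.nrm_add[of ?u "x r"] mem by (simp add: Er.diff_add_cancel Er.add_closed Er.scale_closed)
        also have "nrm (E r) ?u = ndist (E r) (x r) (y r)"
          using mem Metric_space.commute[OF EM[OF r], of "x r" "y r"] by (simp add: ndist_def)
        finally show ?thesis
          using yd[OF r] \<delta>(2) xK[OF r] by simp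
      qed
      moreover have "nrm (E r) (x r) \<le> K" if "r \<in> {1..d}" for r
        using xK[OF that] by simp
      ultimately have "ndist F (A x) (A y) \<le> real d * (C * K ^ d * \<delta>)"
        using yd by (intro ndist_op_le[OF x yt C bound K1]) (auto intro: less_imp_le)
      also have "\<dots> < e"
        using \<delta>(3) by (simp add: M_def mult_ac)
      finally show ?thesis
        using op_closed[OF x] op_closed[OF yt] by simp
    qed
    ultimately show "\<exists>U. openin ?X U \<and> x \<in> U \<and> (\<forall>y\<in>U. A y \<in> FM.mball (A x) e)"
      by blast
  qed
  with multilinear show ?thesis
    by (simp add: cont_multilinear_ops_def)
qed

end

section \<open>Partially multiple summing and block-summing operators\<close>

locale block_multilinear_op = multilinear_op d E F A
  for d and E :: "nat \<Rightarrow> ('k::{real_normed_field, banach}, 'a) nspace" and F :: "('k, 'b) nspace" and A +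
  fixes k :: nat and I :: "nat \<Rightarrow> nat set" and p q :: "nat \<Rightarrow> real"
  assumes part: "ordered_partition d k I"
    and p_ge_1: "\<And>r. r \<in> {1..d} \<Longrightarrow> 1 \<le> p r"
    and q_ge_1: "\<And>s. s \<in> {1..k} \<Longrightarrow> 1 \<le> q s"
begin

abbreviation weak_tuples where
  "weak_tuples \<equiv> {x. \<forall>r\<in>{1..d}. x r \<in> ell_weak (p r) (E r)}"

abbreviation weak_ball where
  "weak_ball \<equiv> {x. \<forall>r\<in>{1..d}. x r \<in> ell_weak (p r) (E r) \<and> weak_norm (p r) (E r) (x r) \<le> 1}"

text \<open>The common quantity behind both classes of operators. It is kept in [0,infinity] so that
  homogeneity and comparison hold before finiteness is known.\<close>

definition image_sum where
  "image_sum x = nested_sum (exponents k q) 1 F (\<lambda>ns. A (block_tuple d k I x ns))"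

lemma exponents_pos: "\<forall>t\<in>set (exponents k q). 0 < t"
  using q_ge_1 by (fastforce intro: less_le_trans[OF zero_less_one])

lemma block_tuple_closed:
  assumes "x \<in> weak_tuples"
  shows "block_tuple d k I x ns \<in> tuples"
  unfolding block_tuple_def restrict_PiE_iff using assms by (auto simp: ell_weak_def)

lemma weak_norm_ge_0: "\<lbrakk>x \<in> weak_tuples; r \<in> {1..d}\<rbrakk> \<Longrightarrow> 0 \<le> weak_norm (p r) (E r) (x r)"
  by (rule weak_norm_nonneg[OF normed_E p_ge_1]) auto

lemma scale_weak_tuples: "x \<in> weak_tuples \<Longrightarrow> (\<lambda>r j. scale (E r) (c r) (x r j)) \<in> weak_tuples"
  by (auto intro: scale_in_ell_weak[OF normed_E])

lemma image_sum_scale: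
  assumes "x \<in> weak_tuples" "\<And>r. r \<in> {1..d} \<Longrightarrow> c r \<noteq> 0"
  shows "image_sum (\<lambda>r j. scale (E r) (c r) (x r j)) = ennreal (\<Prod>r\<in>{1..d}. norm (c r)) * image_sum x"
proof -
  have pos: "0 < (\<Prod>r\<in>{1..d}. norm (c r))"
    using assms(2) by (intro prod_pos) auto
  have "nrm F (A (block_tuple d k I (\<lambda>r j. scale (E r) (c r) (x r j)) ns))
      = (\<Prod>r\<in>{1..d}. norm (c r)) * nrm F (A (block_tuple d k I x ns))" for ns
    using nrm_op_scale_all[OF block_tuple_closed[OF assms(1)], of c ns]
    by (simp add: block_tuple_def cong: restrict_cong)
  then show ?thesis
    unfolding image_sum_def using pos exponents_pos
    by (subst nested_sum_cmult[OF exponents_pos pos]) auto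
qed

lemma summing_bound_iff_ball:
  assumes M: "0 \<le> M"
  shows "summing_bound d k I p q E F A M \<longleftrightarrow> (\<forall>x\<in>weak_ball. image_sum x \<le> ennreal M)"
proof
  assume *: "summing_bound d k I p q E F A M"
  show "\<forall>x\<in>weak_ball. image_sum x \<le> ennreal M"
  proof
    fix x assume x: "x \<in> weak_ball"
    then have "(\<Prod>r\<in>{1..d}. weak_norm (p r) (E r) (x r)) \<le> 1"
      using weak_norm_ge_0 by (intro prod_le_1) auto
    then have "ennreal (M * (\<Prod>r\<in>{1..d}. weak_norm (p r) (E r) (x r))) \<le> ennreal M"
      using M by (intro ennreal_leI) (simp add: mult_left_le)
    then show "image_sum x \<le> ennreal M"
      using * x unfolding summing_bound_def image_sum_def by (blast intro: order_trans)
  qed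
next
  assume *: "\<forall>x\<in>weak_ball. image_sum x \<le> ennreal M"
  show "summing_bound d k I p q E F A M"
    unfolding summing_bound_def
  proof (intro allI impI)
    fix x assume "\<forall>r\<in>{1..d}. x r \<in> ell_weak (p r) (E r)"
    then have x: "x \<in> weak_tuples"
      by simp
    let ?w = "\<lambda>r. weak_norm (p r) (E r) (x r)"
    \<comment> \<open>A weak norm may be 0, so it cannot be divided by; each coordinate is
      normalised by its weak norm plus \<open>\<delta>\<close>, and \<open>\<delta>\<close> tends to
      0 afterwards.\<close>
    have le: "image_sum x \<le> ennreal (M * (\<Prod>r\<in>{1..d}. ?w r + \<delta>))" if \<delta>: "0 < \<delta>" for \<delta>
    proof -
      have w: "0 < ?w r + \<delta>" if "r \<in> {1..d}" for r
        using weak_norm_ge_0[OF x that] \<delta> by simp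
      define c :: "nat \<Rightarrow> 'k" where "c r = of_real (1 / (?w r + \<delta>))" for r
      have nc: "norm (c r) = 1 / (?w r + \<delta>)" "c r \<noteq> 0" if "r \<in> {1..d}" for r
        using w[OF that] by (auto simp: c_def norm_divide simp flip: of_real_add)
      have "weak_norm (p r) (E r) (\<lambda>j. scale (E r) (c r) (x r j)) \<le> 1" if r: "r \<in> {1..d}" for r
      proof -
        have "weak_norm (p r) (E r) (\<lambda>j. scale (E r) (c r) (x r j)) \<le> norm (c r) * ?w r"
          using x r by (intro weak_norm_scale_le normed_E p_ge_1) auto
        also have "\<dots> \<le> 1"
          using w[OF r] \<delta> by (simp add: nc[OF r])
        finally show ?thesis .
      qed
      with scale_weak_tuples[OF x, of c]
      have "image_sum (\<lambda>r j. scale (E r) (c r) (x r j)) \<le> ennreal M"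
        using * by simp
      then have scaled: "ennreal (\<Prod>r\<in>{1..d}. ?w r + \<delta>) * (ennreal (\<Prod>r\<in>{1..d}. norm (c r)) * image_sum x)
          \<le> ennreal (\<Prod>r\<in>{1..d}. ?w r + \<delta>) * ennreal M"
        using image_sum_scale[OF x nc(2)] by (simp add: mult_left_mono)
      moreover have "(\<Prod>r\<in>{1..d}. ?w r + \<delta>) * (\<Prod>r\<in>{1..d}. norm (c r)) = 1"
        unfolding prod.distrib[symmetric] using w nc by (intro prod.neutral) force
      moreover have "0 \<le> (\<Prod>r\<in>{1..d}. ?w r + \<delta>)"
        using less_imp_le[OF w] by (rule prod_nonneg)
      moreover have "0 \<le> (\<Prod>r\<in>{1..d}. norm (c r))"
        by (rule prod_nonneg) simp
      ultimately have "ennreal (\<Prod>r\<in>{1..d}. ?w r + \<delta>) * ennreal (\<Prod>r\<in>{1..d}. norm (c r)) = 1"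
        by (metis ennreal_1 ennreal_mult)
      then have "image_sum x \<le> ennreal (\<Prod>r\<in>{1..d}. ?w r + \<delta>) * ennreal M"
        using scaled by (simp flip: mult.assoc)
      also have "\<dots> = ennreal (M * (\<Prod>r\<in>{1..d}. ?w r + \<delta>))"
        using M \<open>0 \<le> (\<Prod>r\<in>{1..d}. ?w r + \<delta>)\<close> by (subst ennreal_mult) (auto simp: mult.commute)
      finally show ?thesis .
    qed
    have "((\<lambda>\<delta>. ennreal (M * (\<Prod>r\<in>{1..d}. ?w r + \<delta>))) \<longlongrightarrow> ennreal (M * (\<Prod>r\<in>{1..d}. ?w r + 0))) (at_right 0)"
      by (intro tendsto_intros)
    moreover have "\<forall>\<^sub>F \<delta> in at_right 0. image_sum x \<le> ennreal (M * (\<Prod>r\<in>{1..d}. ?w r + \<delta>))"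
      by (rule eventually_mono[OF eventually_at_right_less[of 0] le])
    ultimately have "image_sum x \<le> ennreal (M * (\<Prod>r\<in>{1..d}. ?w r + 0))"
      by (rule tendsto_lowerbound) simp
    then show "nested_sum (exponents k q) 1 F (\<lambda>ns. A (block_tuple d k I x ns))
        \<le> ennreal (M * (\<Prod>r\<in>{1..d}. ?w r))"
      by (simp add: image_sum_def)
  qed
qed

lemma cont_if_summing_bound:
  assumes C: "0 \<le> C" and bound: "summing_bound d k I p q E F A C"
  shows "A \<in> cont_multilinear_ops d E F"
proof (rule cont_multilinear_if_bounded[OF C])
  fix u assume u: "u \<in> tuples"
  \<comment> \<open>With \<open>u r\<close> placed at index 0, the block point with all indices 0
    gives back \<open>u\<close>, and each weak norm is at most the norm of
    \<open>u r\<close>.\<close>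
  define x where "x r = (\<lambda>j :: nat. if j = 0 then u r else zero (E r))" for r
  have ur: "u r \<in> nspace.carrier (E r)" if "r \<in> {1..d}" for r
    by (rule PiE_mem[OF u that])
  have x: "x \<in> weak_tuples"
    unfolding x_def using single_in_ell_weak(1)[OF normed_E ur p_ge_1] by simp
  have "block_tuple d k I x (replicate k 0) = u"
  proof
    fix r
    show "block_tuple d k I x (replicate k 0) r = u r"
      using u part_of_in[OF part, of r]
      by (auto simp: block_tuple_def block_point_def x_def PiE_def extensional_def)
  qed
  then have "ennreal (nrm F (A u) powr 1) \<le> image_sum x"
    using nested_sum_ge_term[OF exponents_pos, of 1 F "\<lambda>ns. A (block_tuple d k I x ns)"]
    by (simp add: image_sum_def del: upt_Suc)
  also have "\<dots> \<le> ennreal (C * (\<Prod>r\<in>{1..d}. weak_norm (p r) (E r) (x r)))"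
    using bound x by (auto simp: summing_bound_def image_sum_def)
  also have "\<dots> \<le> ennreal (C * (\<Prod>r\<in>{1..d}. nrm (E r) (u r)))"
    using single_in_ell_weak(2)[OF normed_E ur p_ge_1] weak_norm_ge_0[OF x] C
    by (intro ennreal_leI mult_left_mono prod_mono) (auto simp: x_def)
  finally have "ennreal (nrm F (A u)) \<le> ennreal (C * (\<Prod>r\<in>{1..d}. nrm (E r) (u r)))"
    using normed_space.nrm_nonneg[OF normed_F op_closed[OF u]] by simp
  moreover have "0 \<le> C * (\<Prod>r\<in>{1..d}. nrm (E r) (u r))"
    using C normed_space.nrm_nonneg[OF normed_E ur] by (intro mult_nonneg_nonneg prod_nonneg) auto
  ultimately show "nrm F (A u) \<le> C * (\<Prod>r\<in>{1..d}. nrm (E r) (u r))"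
    by (simp add: ennreal_le_iff)
qed

lemma image_in_ell_iter_iff:
  assumes "x \<in> weak_tuples"
  shows "(\<lambda>ns. A (block_tuple d k I x ns)) \<in> ell_iter (exponents k q) F \<longleftrightarrow> image_sum x < top"
proof
  assume "(\<lambda>ns. A (block_tuple d k I x ns)) \<in> ell_iter (exponents k q) F"
  then show "image_sum x < top"
    unfolding image_sum_def by (subst nested_sum_eq_ell_iter_norm[OF exponents_pos]) auto
next
  assume "image_sum x < top"
  then show "(\<lambda>ns. A (block_tuple d k I x ns)) \<in> ell_iter (exponents k q) F"
    unfolding image_sum_def
    by (rule ell_iter_if_nested_sum_finite[OF exponents_pos]) (rule op_closed[OF block_tuple_closed[OF assms]])
qed

lemma image_sum_eq_ell_iter_norm:
  assumes "x \<in> weak_tuples" "image_sum x < top"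
  shows "image_sum x = ennreal (ell_iter_norm (exponents k q) F (\<lambda>ns. A (block_tuple d k I x ns)))"
    and "0 \<le> ell_iter_norm (exponents k q) F (\<lambda>ns. A (block_tuple d k I x ns))"
proof -
  have mem: "(\<lambda>ns. A (block_tuple d k I x ns)) \<in> ell_iter (exponents k q) F"
    using assms image_in_ell_iter_iff by blast
  show nonneg: "0 \<le> ell_iter_norm (exponents k q) F (\<lambda>ns. A (block_tuple d k I x ns))"
    by (rule ell_iter_norm_nonneg[OF mem normed_space.nrm_nonneg[OF normed_F]])
  show "image_sum x = ennreal (ell_iter_norm (exponents k q) F (\<lambda>ns. A (block_tuple d k I x ns)))"
    using nonneg unfolding image_sum_def by (subst nested_sum_eq_ell_iter_norm[OF exponents_pos mem]) simp
qed

text \<open>If no uniform bound existed, scaled copies of a sequence of bad tuples could be interleaved along a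
  bijection between \<open>\<nat> \<times> \<nat>\<close> and \<open>\<nat>\<close> into a single weakly summable tuple whose image sum dominates
  that of each copy.\<close>

lemma image_sum_bounded_on_weak_ball:
  assumes fin: "\<And>x. x \<in> weak_tuples \<Longrightarrow> image_sum x < top"
  shows "\<exists>M\<ge>0. \<forall>x\<in>weak_ball. image_sum x \<le> ennreal M"
proof (rule ccontr)
  assume unbounded: "\<not> ?thesis"
  \<comment> \<open>The factor \<open>2 ^ (m * d)\<close> pays in advance for scaling each of the
    \<open>d\<close> coordinates by 2^-m.\<close>
  have ex: "\<exists>x. x \<in> weak_ball \<and> ennreal (real m * 2 ^ (m * d)) < image_sum x" for m
  proof -
    have "0 \<le> real m * 2 ^ (m * d)"
      by simp
    with unbounded show ?thesis
      by (meson not_le)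
  qed
  obtain x where x: "\<And>m. x m \<in> weak_ball"
    and x_gt: "\<And>m. ennreal (real m * 2 ^ (m * d)) < image_sum (x m)"
    using choice[of "\<lambda>m x. x \<in> weak_ball \<and> ennreal (real m * 2 ^ (m * d)) < image_sum x"] ex
    by blast
  define c :: "nat \<Rightarrow> 'k" where "c m = of_real ((1 / 2) ^ m)" for m
  have nc: "norm (c m) = (1 / 2) ^ m" "c m \<noteq> 0" for m
    by (auto simp: c_def norm_power norm_divide)
  define y where "y r n = (case prod_decode n of (m, j) \<Rightarrow> scale (E r) (c m) (x m r j))" for r n
  have y: "y \<in> weak_tuples"
  proof (intro CollectI ballI)
    fix r assume r: "r \<in> {1..d}"
    show "y r \<in> ell_weak (p r) (E r)"
      unfolding y_def c_def
      by (rule interleave_in_ell_weak[OF normed_E[OF r] p_ge_1[OF r]]) (use x r in auto)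
  qed
  have large: "ennreal (real m) \<le> image_sum y" for m
  proof -
    have xm: "x m \<in> weak_tuples"
      using x[of m] by simp
    define x' where "x' = (\<lambda>r j. scale (E r) (c m) (x m r j))"
    have x': "x' \<in> weak_tuples"
      unfolding x'_def by (rule scale_weak_tuples[OF xm])
    have two: "(2 :: real) ^ (m * d) * ((1 / 2) ^ m) ^ d = 1"
      by (simp add: power_mult power_one_over flip: power_mult_distrib)
    have "ennreal (real m) = ennreal (((1 / 2) ^ m) ^ d * (real m * 2 ^ (m * d)))"
      using two by (simp add: mult_ac)
    also have "\<dots> = ennreal (((1 / 2) ^ m) ^ d) * ennreal (real m * 2 ^ (m * d))"
      by (rule ennreal_mult) auto
    also have "\<dots> \<le> ennreal (((1 / 2) ^ m) ^ d) * image_sum (x m)"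
      using x_gt[of m] by (intro mult_left_mono) auto
    also have "\<dots> = image_sum x'"
      unfolding x'_def using image_sum_scale[OF xm, of "\<lambda>_. c m"] nc by simp
    \<comment> \<open>Along the indices \<open>prod_encode (m, j)\<close> the interleaved tuple
      \<open>y\<close> is exactly the scaled copy \<open>x'\<close>.\<close>
    also have "\<dots> \<le> image_sum y"
      unfolding image_sum_def
    proof (rule nested_sum_reindex_le[OF exponents_pos])
      show "inj (\<lambda>j. prod_encode (m, j))"
        by (auto simp: inj_def)
      fix ns :: "nat list" assume ns: "length ns = length (exponents k q)"
      have "0 \<le> nrm F (A (block_tuple d k I x' ns))"
        by (rule normed_space.nrm_nonneg[OF normed_F op_closed[OF block_tuple_closed[OF x']]])
      moreover have "block_tuple d k I y (map (\<lambda>j. prod_encode (m, j)) ns) = block_tuple d k I x' ns"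
        using ns by (simp add: block_tuple_map[OF part] y_def x'_def)
      ultimately show "0 \<le> nrm F (A (block_tuple d k I x' ns)) \<and> nrm F (A (block_tuple d k I x' ns))
          \<le> nrm F (A (block_tuple d k I y (map (\<lambda>j. prod_encode (m, j)) ns)))"
        by simp
    qed simp
    finally show ?thesis .
  qed
  obtain b where b: "0 \<le> b" "image_sum y = ennreal b"
    using fin[OF y] less_top_ennreal by blast
  obtain m :: nat where "b < real m"
    using reals_Archimedean2 by blast
  with large[of m] b show False
    by (simp add: ennreal_le_iff)
qed

text \<open>Makes the supremum defining the block-summing norm range over a nonempty set, and hence
  nonnegative.\<close>

lemma zero_in_weak_ball: "(\<lambda>r j. zero (E r)) \<in> weak_ball"
proof -
  have "(\<lambda>j. zero (E r)) \<in> ell_weak (p r) (E r) \<and> weak_norm (p r) (E r) (\<lambda>j. zero (E r)) \<le> 1"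
    if r: "r \<in> {1..d}" for r
    using single_in_ell_weak[OF normed_E[OF r] normed_space.zero_closed[OF normed_E[OF r]] p_ge_1[OF r], of 0]
    by (simp add: normed_space.nrm_zero[OF normed_E[OF r]])
  then show ?thesis
    by simp
qed

lemma partially_summing_iff_block_summing:
  "A \<in> partially_summing_ops d k I p q E F \<longleftrightarrow> A \<in> block_summing_ops d k I p q E F"
proof
  assume "A \<in> partially_summing_ops d k I p q E F"
  then obtain C where C: "0 < C" "summing_bound d k I p q E F A C"
    by (auto simp: partially_summing_ops_def)
  have "image_sum x < top" if "x \<in> weak_tuples" for x
    using C(2) that le_less_trans[OF _ ennreal_less_top] by (auto simp: summing_bound_def image_sum_def)
  then have "\<forall>x. (\<forall>r\<in>{1..d}. x r \<in> ell_weak (p r) (E r)) \<longrightarrow>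
      (\<lambda>ns. A (block_tuple d k I x ns)) \<in> ell_iter (exponents k q) F"
    using image_in_ell_iter_iff by simp
  with cont_if_summing_bound[OF less_imp_le C(2)] C(1)
  show "A \<in> block_summing_ops d k I p q E F"
    by (simp add: block_summing_ops_def)
next
  assume A: "A \<in> block_summing_ops d k I p q E F"
  have "image_sum x < top" if "x \<in> weak_tuples" for x
    using A image_in_ell_iter_iff[OF that] that by (simp add: block_summing_ops_def)
  then obtain M where M: "0 \<le> M" "\<forall>x\<in>weak_ball. image_sum x \<le> ennreal M"
    using image_sum_bounded_on_weak_ball by blast
  \<comment> \<open>The summing constant must be strictly positive, and \<open>M\<close> may be
    0.\<close>
  then have "\<forall>x\<in>weak_ball. image_sum x \<le> ennreal (M + 1)"
    by (meson ennreal_leI less_add_one less_imp_le order_trans)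
  with M have "summing_bound d k I p q E F A (M + 1)"
    by (subst summing_bound_iff_ball) auto
  with M multilinear show "A \<in> partially_summing_ops d k I p q E F"
    unfolding partially_summing_ops_def by (auto intro!: exI[of _ "M + 1"])
qed

text \<open>The admissible constants are the positive upper bounds of the mixed norms on the unit
  ball, and the infimum of upper bounds is the supremum.\<close>

lemma partially_summing_norm_eq:
  assumes "A \<in> partially_summing_ops d k I p q E F"
  shows "partially_summing_norm d k I p q E F A = block_summing_norm d k I p q E F A"
proof -
  let ?g = "\<lambda>x. ell_iter_norm (exponents k q) F (\<lambda>ns. A (block_tuple d k I x ns))"
  obtain C where C: "0 < C" "summing_bound d k I p q E F A C"
    using assms by (auto simp: partially_summing_ops_def)
  have fin: "image_sum x < top" if "x \<in> weak_tuples" for x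
    using C(2) that le_less_trans[OF _ ennreal_less_top] by (auto simp: summing_bound_def image_sum_def)
  have bound_iff: "summing_bound d k I p q E F A M \<longleftrightarrow> (\<forall>x\<in>weak_ball. ?g x \<le> M)" if M: "0 \<le> M" for M
    unfolding summing_bound_iff_ball[OF M]
    using M image_sum_eq_ell_iter_norm[OF _ fin] by (intro ball_cong refl) (simp add: ennreal_le_iff)
  define S where "S = (SUP x\<in>weak_ball. ?g x)"
  have bdd: "bdd_above (?g ` weak_ball)"
    using C bound_iff[of C] by (intro bdd_aboveI2[of _ _ C]) auto
  have g_le: "?g x \<le> S" if "x \<in> weak_ball" for x
    unfolding S_def by (rule cSUP_upper[OF that bdd])
  have "0 \<le> ?g (\<lambda>r j. zero (E r))"
    using zero_in_weak_ball by (intro image_sum_eq_ell_iter_norm fin) auto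
  with g_le[OF zero_in_weak_ball] have S0: "0 \<le> S"
    by linarith
  let ?B = "{C. C > 0 \<and> summing_bound d k I p q E F A C}"
  have "Inf ?B \<le> S"
  \<comment> \<open>If \<open>S\<close> is 0 it is not itself an admissible constant, whereas
    \<open>S + e\<close> always is.\<close>
  proof (rule field_le_epsilon)
    fix e :: real assume "0 < e"
    then have "S + e \<in> ?B"
      using S0 bound_iff[of "S + e"] g_le by fastforce
    then show "Inf ?B \<le> S + e"
      by (rule cInf_lower) (auto intro!: bdd_belowI[of _ 0])
  qed
  moreover have "S \<le> Inf ?B"
  proof (rule cInf_greatest)
    fix M assume "M \<in> ?B"
    then show "S \<le> M"
      unfolding S_def using zero_in_weak_ball bound_iff[of M] by (intro cSUP_least) auto
  qed (use C in auto)
  ultimately show ?thesis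
    by (simp add: partially_summing_norm_def block_summing_norm_def S_def)
qed

end

section \<open>Compatibility of the sequence spaces\<close>

lemma weighted_arith_geom_mean:
  fixes a w :: "'i \<Rightarrow> real"
  assumes "finite J" "\<And>r. r \<in> J \<Longrightarrow> 0 \<le> a r" "\<And>r. r \<in> J \<Longrightarrow> 0 \<le> w r" "(\<Sum>r\<in>J. w r) = 1"
  shows "(\<Prod>r\<in>J. a r powr w r) \<le> (\<Sum>r\<in>J. w r * a r)"
proof (cases "\<exists>r\<in>J. a r = 0")
  case True
  \<comment> \<open>A zero factor is excluded from the logarithmic argument below; here
    \<open>0 powr w r\<close> is 0 even for \<open>w r = 0\<close>, so the product vanishes.\<close>
  then have "(\<Prod>r\<in>J. a r powr w r) = 0"
    using assms(1) by (auto simp: prod_zero_iff)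
  moreover have "0 \<le> (\<Sum>r\<in>J. w r * a r)"
    using assms by (intro sum_nonneg) auto
  ultimately show ?thesis
    by simp
next
  case False
  then have pos: "0 < a r" if "r \<in> J" for r
    using assms(2)[OF that] that by force
  have "J \<noteq> {}"
    using assms(4) by auto
  have "(\<Prod>r\<in>J. a r powr w r) = exp (\<Sum>r\<in>J. w r * ln (a r))"
    using assms(1) pos by (auto simp: exp_sum powr_def intro!: prod.cong dest: pos)
  also have "\<dots> \<le> (\<Sum>r\<in>J. w r * exp (ln (a r)))"
    using convex_on_sum[OF assms(1) \<open>J \<noteq> {}\<close> exp_convex assms(4,3), of "\<lambda>r. ln (a r)"] by simp
  also have "\<dots> = (\<Sum>r\<in>J. w r * a r)"
    using pos by (intro sum.cong) auto
  finally show ?thesis .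
qed

text \<open>Each factor is normalised to have p_r-norm 1, and the weighted mean inequality bounds
  the product by a convex combination of series with sum 1. A factor of norm 0 cannot be normalised,
  but then it vanishes identically.\<close>

lemma Hoelder_prod:
  fixes u :: "'i \<Rightarrow> nat \<Rightarrow> real"
  assumes J: "finite J" and q: "0 < q" and p: "\<And>r. r \<in> J \<Longrightarrow> 0 < p r"
    and pq: "1 / q \<le> (\<Sum>r\<in>J. 1 / p r)" and u: "\<And>r n. r \<in> J \<Longrightarrow> 0 \<le> u r n"
    and sm: "\<And>r. r \<in> J \<Longrightarrow> summable (\<lambda>n. u r n powr p r)"
  shows "summable (\<lambda>n. (\<Prod>r\<in>J. u r n) powr q)" (is ?S)
    and "(\<Sum>n. (\<Prod>r\<in>J. u r n) powr q) powr (1 / q) \<le> (\<Prod>r\<in>J. (\<Sum>n. u r n powr p r) powr (1 / p r))" (is ?L)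
proof -
  have "?S \<and> ?L"
  proof (cases "\<exists>r\<in>J. (\<Sum>n. u r n powr p r) = 0")
    case True
    then obtain r where r: "r \<in> J" "(\<Sum>n. u r n powr p r) = 0"
      by blast
    then have "u r n = 0" for n
      using suminf_eq_zero_iff[OF sm[OF r(1)]] by simp
    with r(1) J have "(\<Prod>r\<in>J. u r n) = 0" for n
      by (auto simp: prod_zero_iff)
    then show ?thesis
      by (simp add: prod_nonneg)
  next
    case False
    define W where "W r = (\<Sum>n. u r n powr p r) powr (1 / p r)" for r
    have sum_pos: "0 < (\<Sum>n. u r n powr p r)" if "r \<in> J" for r
      using suminf_nonneg[OF sm[OF that]] False that by force
    then have W: "0 < W r" if "r \<in> J" for r
      using that by (force simp: W_def)
    define v where "v r n = u r n / W r" for r n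
    have v0: "0 \<le> v r n" if "r \<in> J" for r n
      using u W that by (auto simp: v_def less_imp_le)
    have vp: "(\<lambda>n. v r n powr p r) sums 1" if r: "r \<in> J" for r
    proof -
      have "W r powr p r = (\<Sum>n. u r n powr p r)"
        using p[OF r] sum_pos[OF r] by (simp add: W_def powr_powr)
      then show ?thesis
        using sums_divide[OF summable_sums[OF sm[OF r]], of "W r powr p r"] sum_pos[OF r]
        by (simp add: v_def powr_divide)
    qed
    have v1: "v r n powr p r \<le> 1" if r: "r \<in> J" for r n
      using sum_le_suminf[OF sums_summable[OF vp[OF r]], of "{n}"] sums_unique[OF vp[OF r]] by simp
    \<comment> \<open>\<open>t\<close> measures the slack in the exponent condition. Dividing by it
      makes the weights \<open>w r\<close> sum to 1; they do not exceed \<open>q / p r\<close>, and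
      for normalised terms, which are at most 1, a smaller exponent only increases the
      value.\<close>
    define t where "t = q * (\<Sum>r\<in>J. 1 / p r)"
    have t: "1 \<le> t"
      using pq q by (simp add: t_def field_simps)
    define w where "w r = q / (p r * t)" for r
    have w0: "0 \<le> w r" if "r \<in> J" for r
      using q p[OF that] t by (simp add: w_def)
    have "(\<Sum>r\<in>J. w r) = q * (\<Sum>r\<in>J. 1 / p r) / t"
      by (simp add: w_def sum_distrib_left sum_divide_distrib)
    then have w1: "(\<Sum>r\<in>J. w r) = 1"
      using t by (simp flip: t_def)
    have le: "(\<Prod>r\<in>J. v r n) powr q \<le> (\<Sum>r\<in>J. w r * v r n powr p r)" for n
    proof -
      have "(\<Prod>r\<in>J. v r n) powr q = (\<Prod>r\<in>J. v r n powr q)"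
        by (rule prod_powr_distrib)
      also have "\<dots> \<le> (\<Prod>r\<in>J. (v r n powr p r) powr w r)"
      proof (intro prod_mono conjI)
        fix r assume r: "r \<in> J"
        have "v r n powr q = (v r n powr p r) powr (q / p r)"
          using p[OF r] by (simp add: powr_powr)
        also have "\<dots> \<le> (v r n powr p r) powr w r"
        proof (rule powr_mono')
          show "w r \<le> q / p r"
            using t p[OF r] q unfolding w_def by (intro divide_left_mono) auto
        qed (use v1[OF r] in auto)
        finally show "v r n powr q \<le> (v r n powr p r) powr w r" .
      qed simp
      also have "\<dots> \<le> (\<Sum>r\<in>J. w r * v r n powr p r)"
        using J w0 w1 by (intro weighted_arith_geom_mean) auto
      finally show ?thesis .
    qed
    have "(\<lambda>n. \<Sum>r\<in>J. w r * v r n powr p r) sums (\<Sum>r\<in>J. w r * 1)"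
      using vp by (intro sums_sum sums_mult)
    then have major: "(\<lambda>n. \<Sum>r\<in>J. w r * v r n powr p r) sums 1"
      by (simp add: w1)
    have smv: "summable (\<lambda>n. (\<Prod>r\<in>J. v r n) powr q)"
      by (rule summable_comparison_test'[OF sums_summable[OF major]]) (use le in auto)
    have "(\<Sum>n. (\<Prod>r\<in>J. v r n) powr q) \<le> 1"
      using suminf_le[OF le smv sums_summable[OF major]] sums_unique[OF major] by simp
    have u_eq: "(\<Prod>r\<in>J. u r n) powr q = (\<Prod>r\<in>J. W r) powr q * (\<Prod>r\<in>J. v r n) powr q" for n
    proof -
      have "(\<Prod>r\<in>J. u r n) = (\<Prod>r\<in>J. W r) * (\<Prod>r\<in>J. v r n)"
        unfolding prod.distrib[symmetric] using W by (intro prod.cong) (force simp: v_def)+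
      then show ?thesis
        by (simp add: powr_mult)
    qed
    have ?S
      unfolding u_eq using smv by (rule summable_mult)
    moreover have ?L
    proof -
      have "(\<Sum>n. (\<Prod>r\<in>J. u r n) powr q) = (\<Prod>r\<in>J. W r) powr q * (\<Sum>n. (\<Prod>r\<in>J. v r n) powr q)"
        unfolding u_eq using smv by (rule suminf_mult)
      also have "\<dots> \<le> (\<Prod>r\<in>J. W r) powr q * 1"
        using \<open>(\<Sum>n. (\<Prod>r\<in>J. v r n) powr q) \<le> 1\<close> by (intro mult_left_mono) auto
      finally have "(\<Sum>n. (\<Prod>r\<in>J. u r n) powr q) powr (1 / q) \<le> ((\<Prod>r\<in>J. W r) powr q) powr (1 / q)"
        using q \<open>?S\<close> by (intro powr_mono2 suminf_nonneg) auto
      also have "\<dots> = (\<Prod>r\<in>J. W r)"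
        using q W by (simp add: powr_powr prod_nonneg less_imp_le)
      finally show ?thesis
        by (simp add: W_def)
    qed
    ultimately show ?thesis ..
  qed
  then show ?S ?L
    by auto
qed

section \<open>Scalar sequences and mixed norms of products\<close>

lemma normed_space_scalar_space:
  "normed_space (scalar_space :: ('k::{real_normed_field, banach}, 'k) nspace)"
  using banach_space_scalar_space banach_space_def by blast

text \<open>Testing a scalar sequence on the identity bounds its ordinary p-norm by its weak
  p-norm.\<close>

lemma id_in_dual_ball_scalar:
  "(\<lambda>x. x) \<in> dual_ball (scalar_space :: ('k::{real_normed_field, banach}, 'k) nspace)"
  using normed_space.dualI[OF normed_space_scalar_space, of "\<lambda>x. x" 1]
  by (auto simp: dual_ball_def scalar_space_def)

lemma ell_weak_scalar:
  fixes x :: "nat \<Rightarrow> 'k::{real_normed_field, banach}"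
  assumes "x \<in> ell_weak p scalar_space"
  shows "summable (\<lambda>j. norm (x j) powr p)"
    and "1 \<le> p \<Longrightarrow> (\<Sum>j. norm (x j) powr p) powr (1 / p) \<le> weak_norm p scalar_space x"
proof -
  show "summable (\<lambda>j. norm (x j) powr p)"
    using assms id_in_dual_ball_scalar by (auto simp: ell_weak_def dual_ball_def)
  show "1 \<le> p \<Longrightarrow> (\<Sum>j. norm (x j) powr p) powr (1 / p) \<le> weak_norm p scalar_space x"
    using weak_norm_upper[OF normed_space_scalar_space _ assms id_in_dual_ball_scalar] .
qed

text \<open>Test sequences for the necessity of the exponent condition, where only an upper bound
  for the weak norm matters.\<close>

lemma initial_segment_in_ell_weak:
  fixes N :: nat
  assumes "1 \<le> p"
  shows "(\<lambda>j. if j < N then 1 else 0) \<in> ell_weak p (scalar_space :: ('k::{real_normed_field, banach}, 'k) nspace)"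
    and "weak_norm p (scalar_space :: ('k, 'k) nspace) (\<lambda>j. if j < N then 1 else 0) \<le> real N powr (1 / p)"
proof -
  let ?K = "scalar_space :: ('k, 'k) nspace" and ?x = "\<lambda>j. if j < N then 1 else 0 :: 'k"
  have eq: "(\<lambda>j. norm (\<phi> (?x j)) powr p) = (\<lambda>j. if j \<in> {..<N} then norm (\<phi> 1) powr p else 0)"
    if "\<phi> \<in> dual ?K" for \<phi>
  proof -
    have "\<phi> (c * y) = c * \<phi> y" for c y
      using that by (simp add: dual_def scalar_space_def)
    from this[of 0 0] show ?thesis
      by auto
  qed
  then show "?x \<in> ell_weak p ?K"
    by (auto simp: ell_weak_def scalar_space_def)
  show "weak_norm p ?K ?x \<le> real N powr (1 / p)"
  proof (rule weak_norm_le[OF normed_space_scalar_space])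
    fix \<phi> assume \<phi>: "\<phi> \<in> dual_ball ?K"
    then have "norm (\<phi> 1) \<le> 1"
      unfolding dual_ball_def scalar_space_def by (auto dest: spec[of _ 1])
    then have "norm (\<phi> 1) powr p \<le> 1"
      using assms powr_mono2[of p "norm (\<phi> 1)" 1] by simp
    then have "real N * norm (\<phi> 1) powr p \<le> real N"
      by (simp add: mult_left_le)
    moreover have "(\<Sum>j. norm (\<phi> (?x j)) powr p) = real N * norm (\<phi> 1) powr p"
      using sums_unique[OF sums_If_finite_set[of "{..<N}" "\<lambda>_. norm (\<phi> 1) powr p"]] eq[of \<phi>] \<phi>
      by (simp add: dual_ball_def)
    ultimately show "(\<Sum>j. norm (\<phi> (?x j)) powr p) powr (1 / p) \<le> real N powr (1 / p)"
      using assms by (intro powr_mono2) auto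
  qed
qed

text \<open>The scalar \<open>c\<close> collects the entries fixed by the outer indices: slicing at
  \<open>n\<close> replaces \<open>c\<close> by \<open>c * b s n\<close>, so the induction closes
  and the norm splits off one factor per level.\<close>

lemma ell_iter_prod:
  fixes b :: "nat \<Rightarrow> nat \<Rightarrow> 'k::real_normed_field"
  assumes "\<And>s. s \<in> set ss \<Longrightarrow> 0 < q s \<and> summable (\<lambda>n. norm (b s n) powr q s)"
  shows "(\<lambda>ns. c * (\<Prod>i<length ss. b (ss ! i) (ns ! i))) \<in> ell_iter (map q ss) scalar_space \<and>
    ell_iter_norm (map q ss) scalar_space (\<lambda>ns. c * (\<Prod>i<length ss. b (ss ! i) (ns ! i)))
      = norm c * (\<Prod>s\<leftarrow>ss. (\<Sum>n. norm (b s n) powr q s) powr (1 / q s))"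
  using assms
proof (induction ss arbitrary: c)
  case Nil
  then show ?case
    by (simp add: scalar_space_def)
next
  case (Cons s ss)
  let ?P = "\<Prod>s\<leftarrow>ss. (\<Sum>n. norm (b s n) powr q s) powr (1 / q s)"
  let ?a = "\<lambda>c ns. c * (\<Prod>i<length ss. b (ss ! i) (ns ! i))"
  have P: "0 \<le> ?P"
    by (intro prod_list_nonneg) auto
  have q: "0 < q s" and sm: "summable (\<lambda>n. norm (b s n) powr q s)"
    using Cons.prems by auto
  have IH: "?a c \<in> ell_iter (map q ss) scalar_space"
    "ell_iter_norm (map q ss) scalar_space (?a c) = norm c * ?P" for c
    using Cons.IH[of c] Cons.prems by auto
  have slice: "(\<lambda>ns. c * (\<Prod>i<length (s # ss). b ((s # ss) ! i) ((n # ns) ! i))) = ?a (c * b s n)" for n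
    by (simp add: prod.lessThan_Suc_shift mult_ac del: prod.lessThan_Suc)
  have tm: "ell_iter_norm (map q ss) scalar_space (?a (c * b s n)) powr q s
      = (norm c * ?P) powr q s * norm (b s n) powr q s" for n
    unfolding IH norm_mult powr_mult by (simp add: mult_ac)
  have tot: "(\<Sum>n. (norm c * ?P) powr q s * norm (b s n) powr q s) powr (1 / q s)
      = norm c * ?P * (\<Sum>n. norm (b s n) powr q s) powr (1 / q s)"
    using sm q P by (simp add: suminf_mult powr_mult powr_powr)
  show ?case
    unfolding list.map(2) ell_iter.simps ell_iter_norm.simps mem_Collect_eq slice tm tot
    by (intro conjI allI IH(1) summable_mult sm) (simp add: mult_ac)
qed

lemma ell_iter_block_prod:
  fixes b :: "nat \<Rightarrow> nat \<Rightarrow> 'k::real_normed_field"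
  assumes "\<And>s. s \<in> {1..k} \<Longrightarrow> 0 < q s \<and> summable (\<lambda>n. norm (b s n) powr q s)"
  shows "(\<lambda>ns. \<Prod>s\<in>{1..k}. b s (ns ! (s - 1))) \<in> ell_iter (exponents k q) scalar_space"
    and "ell_iter_norm (exponents k q) scalar_space (\<lambda>ns. \<Prod>s\<in>{1..k}. b s (ns ! (s - 1)))
      = (\<Prod>s\<in>{1..k}. (\<Sum>n. norm (b s n) powr q s) powr (1 / q s))"
proof -
  have "(\<lambda>ns. \<Prod>s\<in>{1..k}. b s (ns ! (s - 1)))
      = (\<lambda>ns. 1 * (\<Prod>i<length [1..<Suc k]. b ([1..<Suc k] ! i) (ns ! i)))"
    by (simp add: prod.atLeast1_atMost_eq del: upt_Suc)
  moreover have "(\<Prod>s\<leftarrow>[1..<Suc k]. f s) = (\<Prod>s\<in>{1..k}. f s)" for f :: "nat \<Rightarrow> real"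
    using prod.distinct_set_conv_list[of "[1..<Suc k]" f] by (simp add: atLeastLessThanSuc_atLeastAtMost del: upt_Suc)
  moreover have "\<And>s. s \<in> set [1..<Suc k] \<Longrightarrow> 0 < q s \<and> summable (\<lambda>n. norm (b s n) powr q s)"
    using assms by auto
  ultimately show "(\<lambda>ns. \<Prod>s\<in>{1..k}. b s (ns ! (s - 1))) \<in> ell_iter (exponents k q) scalar_space"
    and "ell_iter_norm (exponents k q) scalar_space (\<lambda>ns. \<Prod>s\<in>{1..k}. b s (ns ! (s - 1)))
      = (\<Prod>s\<in>{1..k}. (\<Sum>n. norm (b s n) powr q s) powr (1 / q s))"
    using ell_iter_prod[of "[1..<Suc k]" q b 1] by (simp_all del: upt_Suc)
qed

lemma prod_ordered_partition:
  assumes "ordered_partition d k I"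
  shows "(\<Prod>s\<in>{1..k}. \<Prod>r\<in>I s. f r) = (\<Prod>r\<in>{1..d}. f r)"
proof -
  have fin: "finite (I s)" if "s \<in> {1..k}" for s
    using ordered_partition_subset[OF assms that] by (rule finite_subset) simp
  have "{1..d} = (\<Union>s\<in>{1..k}. I s)"
    using assms by (simp add: ordered_partition_def)
  then show ?thesis
    using assms fin by (simp only:, subst prod.UNION_disjoint) (auto simp: ordered_partition_def disjoint_family_on_def)
qed

lemma block_compatible_iff:
  fixes p q :: "nat \<Rightarrow> real"
  assumes part: "ordered_partition d k I"
    and p: "\<And>r. r \<in> {1..d} \<Longrightarrow> 1 \<le> p r" and q: "\<And>s. s \<in> {1..k} \<Longrightarrow> 1 \<le> q s"
  shows "block_compatible TYPE('k::{real_normed_field, banach}) d k I p q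
    \<longleftrightarrow> (\<forall>s\<in>{1..k}. 1 / q s \<le> (\<Sum>r\<in>I s. 1 / p r))"
proof
  have Isub: "I s \<subseteq> {1..d}" if "s \<in> {1..k}" for s
    using part that by (rule ordered_partition_subset)
  then have Ifin: "finite (I s)" if "s \<in> {1..k}" for s
    using that finite_subset by blast
  let ?K = "scalar_space :: ('k, 'k) nspace"
  {
    assume pq: "\<forall>s\<in>{1..k}. 1 / q s \<le> (\<Sum>r\<in>I s. 1 / p r)"
    show "block_compatible TYPE('k) d k I p q"
      unfolding block_compatible_def Let_def
    proof (intro allI impI)
      fix x :: "nat \<Rightarrow> nat \<Rightarrow> 'k"
      assume x: "\<forall>r\<in>{1..d}. x r \<in> ell_weak (p r) scalar_space"
      define b where "b s n = (\<Prod>r\<in>I s. x r n)" for s n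
      let ?b = "\<lambda>s. (\<Sum>n. norm (b s n) powr q s) powr (1 / q s)"
      have b: "summable (\<lambda>n. norm (b s n) powr q s)"
        "?b s \<le> (\<Prod>r\<in>I s. (\<Sum>n. norm (x r n) powr p r) powr (1 / p r))" if s: "s \<in> {1..k}" for s
      proof -
        have "0 < q s" "1 / q s \<le> (\<Sum>r\<in>I s. 1 / p r)"
          using q[OF s] pq s by auto
        moreover have "0 < p r" "summable (\<lambda>n. norm (x r n) powr p r)" if "r \<in> I s" for r
          using p[of r] Isub[OF s] that x ell_weak_scalar(1) by force+
        ultimately show "summable (\<lambda>n. norm (b s n) powr q s)"
          "?b s \<le> (\<Prod>r\<in>I s. (\<Sum>n. norm (x r n) powr p r) powr (1 / p r))"
          unfolding b_def prod_norm[symmetric]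
          using Hoelder_prod[OF Ifin[OF s], of "q s" p "\<lambda>r n. norm (x r n)"] by auto
      qed
      have "(\<Prod>s\<in>{1..k}. ?b s) \<le> (\<Prod>s\<in>{1..k}. \<Prod>r\<in>I s. weak_norm (p r) scalar_space (x r))"
      proof (intro prod_mono conjI)
        fix s assume s: "s \<in> {1..k}"
        note b(2)[OF s]
        also have "(\<Prod>r\<in>I s. (\<Sum>n. norm (x r n) powr p r) powr (1 / p r))
            \<le> (\<Prod>r\<in>I s. weak_norm (p r) scalar_space (x r))"
          using x p Isub[OF s] by (intro prod_mono conjI ell_weak_scalar(2)) auto
        finally show "?b s \<le> (\<Prod>r\<in>I s. weak_norm (p r) scalar_space (x r))" .
      qed simp
      also have "\<dots> = (\<Prod>r\<in>{1..d}. weak_norm (p r) scalar_space (x r))"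
        by (rule prod_ordered_partition[OF part])
      finally have le: "(\<Prod>s\<in>{1..k}. ?b s) \<le> (\<Prod>r\<in>{1..d}. weak_norm (p r) scalar_space (x r))" .
      have "0 < q s \<and> summable (\<lambda>n. norm (b s n) powr q s)" if "s \<in> {1..k}" for s
        using q[OF that] b(1)[OF that] by simp
      from ell_iter_block_prod[of k q b, OF this] le
      show "(\<lambda>ns. \<Prod>s\<in>{1..k}. \<Prod>r\<in>I s. x r (ns ! (s - 1))) \<in> ell_iter (exponents k q) scalar_space \<and>
          ell_iter_norm (exponents k q) scalar_space (\<lambda>ns. \<Prod>s\<in>{1..k}. \<Prod>r\<in>I s. x r (ns ! (s - 1)))
            \<le> (\<Prod>r\<in>{1..d}. weak_norm (p r) scalar_space (x r))"
        by (simp add: b_def)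
    qed
  }
  assume compat: "block_compatible TYPE('k) d k I p q"
  show "\<forall>s\<in>{1..k}. 1 / q s \<le> (\<Sum>r\<in>I s. 1 / p r)"
  proof
    fix s assume s: "s \<in> {1..k}"
    \<comment> \<open>Coordinates in \<open>I s\<close> get the indicator of two points, all others
      that of one point. Block products are then indicators of \<open>M s'\<close> points, and
      compatibility reduces to comparing two powers of 2, hence their exponents.\<close>
    define N :: "nat \<Rightarrow> nat" where "N r = (if r \<in> I s then 2 else 1)" for r
    define M :: "nat \<Rightarrow> nat" where "M s' = (if s' = s then 2 else 1)" for s'
    define x :: "nat \<Rightarrow> nat \<Rightarrow> 'k" where "x r n = (if n < N r then 1 else 0)" for r n
    define b :: "nat \<Rightarrow> nat \<Rightarrow> 'k" where "b s' n = (if n < M s' then 1 else 0)" for s' n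
    have x: "x r \<in> ell_weak (p r) ?K" "weak_norm (p r) ?K (x r) \<le> real (N r) powr (1 / p r)"
      if "r \<in> {1..d}" for r
      unfolding x_def using initial_segment_in_ell_weak[OF p[OF that], of "N r", where ?'k = 'k] by auto
    have NM: "N r = M s'" if "s' \<in> {1..k}" "r \<in> I s'" for r s'
      using ordered_partition_unique[OF part s that(1) _ that(2)] that(2) by (auto simp: N_def M_def)
    have b: "(\<Prod>r\<in>I s'. x r n) = b s' n" if s': "s' \<in> {1..k}" for s' n
    proof -
      have "(\<Prod>r\<in>I s'. x r n) = (\<Prod>r\<in>I s'. b s' n)"
        using NM[OF s'] by (intro prod.cong) (auto simp: x_def b_def)
      \<comment> \<open>An empty block would give the constant product 1 instead of an
        indicator.\<close>
      moreover have "I s' \<noteq> {}"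
        using part s' by (auto simp: ordered_partition_def)
      ultimately show ?thesis
        using Ifin[OF s'] by (auto simp: b_def power_0_left card_gt_0_iff)
    qed
    have norm_b: "(\<lambda>n. norm (b s' n) powr t) sums real (M s')" for s' t
    proof -
      have "(\<lambda>n. norm (b s' n) powr t) = (\<lambda>n. if n \<in> {..<M s'} then 1 else 0)"
        by (auto simp: b_def)
      then show ?thesis
        using sums_If_finite_set[of "{..<M s'}" "\<lambda>_. 1 :: real"] by simp
    qed
    have qb: "0 < q s' \<and> summable (\<lambda>n. norm (b s' n) powr q s')" if "s' \<in> {1..k}" for s'
      using q[OF that] sums_summable[OF norm_b] by simp
    have b_eq: "(\<lambda>ns. \<Prod>s\<in>{1..k}. \<Prod>r\<in>I s. x r (ns ! (s - 1))) = (\<lambda>ns. \<Prod>s\<in>{1..k}. b s (ns ! (s - 1)))"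
      using b by (intro ext prod.cong) auto
    have "2 powr (1 / q s) = (\<Prod>s'\<in>{1..k}. real (M s') powr (1 / q s'))"
      using s by (subst prod.remove[of _ s]) (auto simp: M_def intro!: prod.neutral)
    also have "\<dots> = ell_iter_norm (exponents k q) ?K (\<lambda>ns. \<Prod>s\<in>{1..k}. b s (ns ! (s - 1)))"
      using ell_iter_block_prod(2)[of k q b, OF qb] sums_unique[OF norm_b] by simp
    also have "\<dots> \<le> (\<Prod>r\<in>{1..d}. weak_norm (p r) ?K (x r))"
      using compat x(1) unfolding block_compatible_def Let_def b_eq[symmetric] by blast
    also have "\<dots> \<le> (\<Prod>r\<in>{1..d}. real (N r) powr (1 / p r))"
      using x p by (intro prod_mono conjI weak_norm_nonneg normed_space_scalar_space) auto
    also have "\<dots> = (\<Prod>r\<in>{1..d} \<inter> I s. 2 powr (1 / p r))"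
      by (subst prod.inter_restrict) (auto simp: N_def intro!: prod.cong)
    also have "\<dots> = 2 powr (\<Sum>r\<in>I s. 1 / p r)"
      using Isub[OF s] Ifin[OF s] by (simp add: powr_sum Int_absorb1)
    finally show "1 / q s \<le> (\<Sum>r\<in>I s. 1 / p r)"
      by simp
  qed
qed

section \<open>The coincidence theorem\<close>

theorem proposition3p5:
  fixes d k :: nat
    and I :: "nat \<Rightarrow> nat set"
    and p q :: "nat \<Rightarrow> real"
  assumes "1 \<le> k" and "k \<le> d"
    and "ordered_partition d k I"
    and "\<forall>r\<in>{1..d}. 1 \<le> p r"
    and "\<forall>s\<in>{1..k}. 1 \<le> q s"
  shows "((\<forall>s\<in>{1..k}. 1 / q s \<le> (\<Sum>r\<in>I s. 1 / p r)) \<longrightarrow>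
          (\<forall>(E :: nat \<Rightarrow> ('k::{real_normed_field, banach}, 'a) nspace) (F :: ('k, 'b) nspace).
            (\<forall>r\<in>{1..d}. banach_space (E r)) \<and> banach_space F \<longrightarrow>
              partially_summing_ops d k I p q E F = block_summing_ops d k I p q E F \<and>
              (\<forall>A \<in> partially_summing_ops d k I p q E F.
                 partially_summing_norm d k I p q E F A = block_summing_norm d k I p q E F A)))
       \<and> ((\<forall>s\<in>{1..k}. 1 / q s \<le> (\<Sum>r\<in>I s. 1 / p r)) \<longleftrightarrow>
          block_compatible TYPE('k) d k I p q)"
proof (intro conjI impI allI)
  fix E :: "nat \<Rightarrow> ('k, 'a) nspace" and F :: "('k, 'b) nspace"
  assume EF: "(\<forall>r\<in>{1..d}. banach_space (E r)) \<and> banach_space F"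
  have op: "block_multilinear_op d E F A k I p q" if "A \<in> multilinear_ops d E F" for A
    using assms EF that
    by (intro block_multilinear_op.intro multilinear_op.intro block_multilinear_op_axioms.intro)
      (auto simp: banach_space_def)
  have "A \<in> partially_summing_ops d k I p q E F \<longleftrightarrow> A \<in> block_summing_ops d k I p q E F" for A
  \<comment> \<open>Both sets contain only multilinear operators, so the locale has to be
    instantiated in the first case alone.\<close>
  proof (cases "A \<in> multilinear_ops d E F")
    case True
    then show ?thesis
      by (rule block_multilinear_op.partially_summing_iff_block_summing[OF op])
  qed (auto simp: partially_summing_ops_def block_summing_ops_def cont_multilinear_ops_def)
  then show "partially_summing_ops d k I p q E F = block_summing_ops d k I p q E F"
    by blast
  show "\<forall>A\<in>partially_summing_ops d k I p q E F.
      partially_summing_norm d k I p q E F A = block_summing_norm d k I p q E F A"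
  proof
    fix A assume A: "A \<in> partially_summing_ops d k I p q E F"
    then have "A \<in> multilinear_ops d E F"
      by (simp add: partially_summing_ops_def)
    from block_multilinear_op.partially_summing_norm_eq[OF op[OF this] A]
    show "partially_summing_norm d k I p q E F A = block_summing_norm d k I p q E F A" .
  qed
next
  show "(\<forall>s\<in>{1..k}. 1 / q s \<le> (\<Sum>r\<in>I s. 1 / p r)) \<longleftrightarrow> block_compatible TYPE('k) d k I p q"
    using block_compatible_iff[of d k I p q, where ?'k = 'k] assms by simp
qed

end
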